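(* Let $(M,\varphi,\xi,\eta,g)$ be an $N(k)$-contact metric manifold, $k\in\mathbb{R}$. Suppose that the metric $g$ is a gradient Ricci soliton, i.e. there are a smooth function $f$ on $M$ and a constant $\lambda\in\mathbb{R}$ with $$\nabla\nabla f=Ric+\lambda g ,$$ where $\nabla\nabla f$ is the Hessian of $f$. Let $Df$ denote the gradient of $f$ with respect to $g$. Then at least one of the following holds: (a) the potential vector field $Df$ is a nullity vector field, i.e. $R(X,Y)Df=0$ for all vector fields $X,Y$ on $M$; (b) $g$ is a shrinking soliton (i.e. $\lambda<0$) and $(M,g)$ is Einstein and Sasakian; (c) $g$ is a steady soliton (i.e. $\lambda=0$) and $(M,g)$ is $3$-dimensional and flat.
   Context: A contact metric manifold is a $(2n+1)$-dimensional smooth manifold $M$ ($n\ge 1$) with a tensor field $\varphi$ of type $(1,1)$, a vector field $\xi$, a $1$-form $\eta$ and a Riemannian metric $g$ such that $\varphi^2=-I+\eta\otimes\xi$, $\eta(\xi)=1$, $\varphi\xi=0$, $\eta\circ\varphi=0$, $g(X,Y)=g(\varphi X,\varphi Y)+\eta(X)\eta(Y)$ and $g(X,\varphi Y)=d\eta(X,Y)$ for all vector fields $X,Y$, where $d\eta(X,Y)=\tfrac12\left(X\eta(Y)-Y\eta(X)-\eta([X,Y])\right)$. $\nabla$ is the Levi-Civita connection of $g$, $R(X,Y)Z=\nabla_X\nabla_YZ-\nabla_Y\nabla_XZ-\nabla_{[X,Y]}Z$ is the curvature tensor, and $Ric$ is the Ricci tensor. For a real constant $k$, an $N(k)$-contact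 metric manifold is a contact metric manifold with $R(X,Y)\xi=k\left(\eta(Y)X-\eta(X)Y\right)$ for all vector fields $X,Y$. A contact metric manifold is Sasakian if it is normal, i.e. $[\varphi,\varphi]+2d\eta\otimes\xi=0$ with $[\varphi,\varphi]$ the Nijenhuis tensor of $\varphi$; equivalently, $R(X,Y)\xi=\eta(Y)X-\eta(X)Y$ for all $X,Y$. It is Einstein if $Ric=a\,g$ for some smooth function $a$. A metric $g$ is a Ricci soliton if $\pounds_Vg+2\,Ric+2\lambda g=0$ for a complete vector field $V$ and a constant $\lambda$, where $\pounds$ is the Lie derivative; it is a gradient Ricci soliton if $V$ is the gradient of $-f$ for a function $f$, in which case the equation becomes $\nabla\nabla f=Ric+\lambda g$. The soliton is shrinking, steady or expanding according as $\lambda$ is negative, zero or positive. *)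

theory Defs
  imports "HOL-Analysis.Analysis" "HOL-Library.Function_Algebras"
begin

section \<open>Smooth functions and smooth manifolds\<close>

text \<open>
  \<open>C_on k S f\<close>: \<open>f\<close> is \<open>k\<close> times continuously differentiable on the open set \<open>S\<close>. On a
  finite-dimensional domain, continuity of all directional derivatives is continuity of the
  derivative.
\<close>

primrec C_on ::
  "nat \<Rightarrow> 'a::euclidean_space set \<Rightarrow> ('a \<Rightarrow> 'b::real_normed_vector) \<Rightarrow> bool" where
  "C_on 0 S f \<longleftrightarrow> continuous_on S f"
| "C_on (Suc k) S f \<longleftrightarrow>
     (\<forall>x\<in>S. f differentiable (at x)) \<and> (\<forall>v. C_on k S (\<lambda>x. frechet_derivative f (at x) v))"

definition smooth_on :: "'a::euclidean_space set \<Rightarrow> ('a \<Rightarrow> 'b::real_normed_vector) \<Rightarrow> bool" where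
  "smooth_on S f \<longleftrightarrow> (\<forall>k. C_on k S f)"

text \<open>
  A manifold is modelled by a Hausdorff, second countable type \<open>'m\<close> together with a smooth
  atlas, whose charts take values in a Euclidean space \<open>'e\<close>; its dimension is \<open>DIM('e)\<close>.
  A chart is a pair of its domain and its coordinate map.
\<close>

type_synonym ('m, 'e) chart = "'m set \<times> ('m \<Rightarrow> 'e)"

definition chart :: "'m::topological_space set \<Rightarrow> ('m \<Rightarrow> 'e::euclidean_space) \<Rightarrow> bool" where
  "chart U c \<longleftrightarrow> open U \<and> open (c ` U) \<and> homeomorphism U (c ` U) c (inv_into U c)"

definition smooth_manifold ::
  "('m::{second_countable_topology, t2_space}, 'e::euclidean_space) chart set \<Rightarrow> bool" where
  "smooth_manifold A \<longleftrightarrow>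
     (\<forall>(U, c)\<in>A. chart U c) \<and>
     (\<Union>(U, c)\<in>A. U) = UNIV \<and>
     (\<forall>(U, c)\<in>A. \<forall>(V, d)\<in>A. smooth_on (c ` (U \<inter> V)) (d \<circ> inv_into U c))"

definition smooth_function :: "('m, 'e::euclidean_space) chart set \<Rightarrow> ('m \<Rightarrow> real) \<Rightarrow> bool" where
  "smooth_function A f \<longleftrightarrow> (\<forall>(U, c)\<in>A. smooth_on (c ` U) (f \<circ> inv_into U c))"


section \<open>Tangent vectors and tensor fields\<close>

text \<open>Pointwise scalar multiplication, complementing the pointwise addition on functions.\<close>

instantiation "fun" :: (type, real_vector) real_vector
begin

definition scaleR_fun :: "real \<Rightarrow> ('a \<Rightarrow> 'b) \<Rightarrow> 'a \<Rightarrow> 'b" where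
  "scaleR_fun r f = (\<lambda>x. r *\<^sub>R f x)"

instance
  by standard (auto simp: scaleR_fun_def fun_eq_iff algebra_simps)

end

lemma scaleR_fun_apply [simp]: "(r *\<^sub>R f) x = r *\<^sub>R f x"
  by (simp add: scaleR_fun_def)

text \<open>
  Tangent vectors at a point are the derivations at that point of the algebra of smooth
  functions. They are set to \<open>0\<close> on functions that are not smooth, so that equality of
  tangent vectors is equality in HOL.
\<close>

type_synonym 'm tangent = "('m \<Rightarrow> real) \<Rightarrow> real"
type_synonym 'm vfield = "'m \<Rightarrow> 'm tangent"

definition tangent_space :: "('m, 'e::euclidean_space) chart set \<Rightarrow> 'm \<Rightarrow> 'm tangent set" where
  "tangent_space A p = {v.
     (\<forall>f h a b. smooth_function A f \<longrightarrow> smooth_function A h \<longrightarrow>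
        v (\<lambda>q. a * f q + b * h q) = a * v f + b * v h) \<and>
     (\<forall>f h. smooth_function A f \<longrightarrow> smooth_function A h \<longrightarrow>
        v (\<lambda>q. f q * h q) = f p * v h + h p * v f) \<and>
     (\<forall>f. \<not> smooth_function A f \<longrightarrow> v f = 0)}"

definition vector_field :: "('m, 'e::euclidean_space) chart set \<Rightarrow> 'm vfield \<Rightarrow> bool" where
  "vector_field A X \<longleftrightarrow>
     (\<forall>p. X p \<in> tangent_space A p) \<and>
     (\<forall>f. smooth_function A f \<longrightarrow> smooth_function A (\<lambda>p. X p f))"

definition lie_bracket :: "'m vfield \<Rightarrow> 'm vfield \<Rightarrow> 'm vfield" where
  "lie_bracket X Y = (\<lambda>p f. X p (\<lambda>q. Y q f) - Y p (\<lambda>q. X q f))"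

definition linear_on_subspace :: "'a::real_vector set \<Rightarrow> ('a \<Rightarrow> 'b::real_vector) \<Rightarrow> bool" where
  "linear_on_subspace T L \<longleftrightarrow>
     (\<forall>v\<in>T. \<forall>w\<in>T. \<forall>a b. L (a *\<^sub>R v + b *\<^sub>R w) = a *\<^sub>R L v + b *\<^sub>R L w)"

definition one_form ::
  "('m, 'e::euclidean_space) chart set \<Rightarrow> ('m \<Rightarrow> 'm tangent \<Rightarrow> real) \<Rightarrow> bool" where
  "one_form A \<eta> \<longleftrightarrow>
     (\<forall>p. linear_on_subspace (tangent_space A p) (\<eta> p)) \<and>
     (\<forall>X. vector_field A X \<longrightarrow> smooth_function A (\<lambda>p. \<eta> p (X p)))"

definition tensor_field_1_1 ::
  "('m, 'e::euclidean_space) chart set \<Rightarrow> ('m \<Rightarrow> 'm tangent \<Rightarrow> 'm tangent) \<Rightarrow> bool" where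
  "tensor_field_1_1 A \<phi> \<longleftrightarrow>
     (\<forall>p. linear_on_subspace (tangent_space A p) (\<phi> p)) \<and>
     (\<forall>p. \<forall>v\<in>tangent_space A p. \<phi> p v \<in> tangent_space A p) \<and>
     (\<forall>X. vector_field A X \<longrightarrow> vector_field A (\<lambda>p. \<phi> p (X p)))"

definition riemannian_metric ::
  "('m, 'e::euclidean_space) chart set \<Rightarrow> ('m \<Rightarrow> 'm tangent \<Rightarrow> 'm tangent \<Rightarrow> real) \<Rightarrow> bool" where
  "riemannian_metric A g \<longleftrightarrow>
     (\<forall>p. \<forall>v\<in>tangent_space A p. linear_on_subspace (tangent_space A p) (g p v)) \<and>
     (\<forall>p. \<forall>v\<in>tangent_space A p. \<forall>w\<in>tangent_space A p. g p v w = g p w v) \<and>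
     (\<forall>p. \<forall>v\<in>tangent_space A p. v \<noteq> 0 \<longrightarrow> g p v v > 0) \<and>
     (\<forall>X Y. vector_field A X \<longrightarrow> vector_field A Y \<longrightarrow> smooth_function A (\<lambda>p. g p (X p) (Y p)))"


section \<open>Levi-Civita connection and curvature\<close>

definition affine_connection ::
  "('m, 'e::euclidean_space) chart set \<Rightarrow> ('m vfield \<Rightarrow> 'm vfield \<Rightarrow> 'm vfield) \<Rightarrow> bool" where
  "affine_connection A nabla \<longleftrightarrow>
     (\<forall>X Y. vector_field A X \<longrightarrow> vector_field A Y \<longrightarrow> vector_field A (nabla X Y)) \<and>
     (\<forall>X Y Z. vector_field A X \<longrightarrow> vector_field A Y \<longrightarrow> vector_field A Z \<longrightarrow>
        nabla (X + Y) Z = nabla X Z + nabla Y Z \<and>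
        nabla X (Y + Z) = nabla X Y + nabla X Z) \<and>
     (\<forall>u X Y. smooth_function A u \<longrightarrow> vector_field A X \<longrightarrow> vector_field A Y \<longrightarrow>
        nabla (\<lambda>p. u p *\<^sub>R X p) Y = (\<lambda>p. u p *\<^sub>R nabla X Y p) \<and>
        nabla X (\<lambda>p. u p *\<^sub>R Y p) = (\<lambda>p. X p u *\<^sub>R Y p + u p *\<^sub>R nabla X Y p))"

text \<open>
  These properties determine \<open>nabla\<close> on smooth vector fields; nothing is said about its
  values on other arguments.
\<close>

definition levi_civita_connection ::
  "('m, 'e::euclidean_space) chart set \<Rightarrow> ('m \<Rightarrow> 'm tangent \<Rightarrow> 'm tangent \<Rightarrow> real) \<Rightarrow>
   ('m vfield \<Rightarrow> 'm vfield \<Rightarrow> 'm vfield) \<Rightarrow> bool" where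
  "levi_civita_connection A g nabla \<longleftrightarrow>
     affine_connection A nabla \<and>
     (\<forall>X Y. vector_field A X \<longrightarrow> vector_field A Y \<longrightarrow>
        nabla X Y - nabla Y X = lie_bracket X Y) \<and>
     (\<forall>X Y Z p. vector_field A X \<longrightarrow> vector_field A Y \<longrightarrow> vector_field A Z \<longrightarrow>
        X p (\<lambda>q. g q (Y q) (Z q)) = g p (nabla X Y p) (Z p) + g p (Y p) (nabla X Z p))"

definition curvature ::
  "('m vfield \<Rightarrow> 'm vfield \<Rightarrow> 'm vfield) \<Rightarrow> 'm vfield \<Rightarrow> 'm vfield \<Rightarrow> 'm vfield \<Rightarrow> 'm vfield" where
  "curvature nabla X Y Z =
     nabla X (nabla Y Z) - nabla Y (nabla X Z) - nabla (lie_bracket X Y) Z"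

definition orthonormal_frame_at ::
  "('m, 'e::euclidean_space) chart set \<Rightarrow> ('m \<Rightarrow> 'm tangent \<Rightarrow> 'm tangent \<Rightarrow> real) \<Rightarrow>
   'm \<Rightarrow> (nat \<Rightarrow> 'm vfield) \<Rightarrow> bool" where
  "orthonormal_frame_at A g p E \<longleftrightarrow>
     (\<forall>i<DIM('e). vector_field A (E i)) \<and>
     (\<forall>i<DIM('e). \<forall>j<DIM('e). g p (E i p) (E j p) = (if i = j then 1 else 0))"

text \<open>
  \<open>Ric(Y,Z)\<close> at \<open>p\<close> is the trace of \<open>x \<mapsto> R(x,Y)Z\<close> on the tangent space at \<open>p\<close>, computed
  in an orthonormal basis; it does not depend on the choice of the basis, nor on the choice
  of the vector fields extending it.
\<close>

definition ricci ::
  "('m, 'e::euclidean_space) chart set \<Rightarrow> ('m \<Rightarrow> 'm tangent \<Rightarrow> 'm tangent \<Rightarrow> real) \<Rightarrow>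
   ('m vfield \<Rightarrow> 'm vfield \<Rightarrow> 'm vfield) \<Rightarrow> 'm vfield \<Rightarrow> 'm vfield \<Rightarrow> 'm \<Rightarrow> real" where
  "ricci A g nabla Y Z p =
     (let E = (SOME E. orthonormal_frame_at A g p E)
      in \<Sum>i<DIM('e). g p (curvature nabla (E i) Y Z p) (E i p))"

definition flat ::
  "('m, 'e::euclidean_space) chart set \<Rightarrow> ('m vfield \<Rightarrow> 'm vfield \<Rightarrow> 'm vfield) \<Rightarrow> bool" where
  "flat A nabla \<longleftrightarrow>
     (\<forall>X Y Z. vector_field A X \<longrightarrow> vector_field A Y \<longrightarrow> vector_field A Z \<longrightarrow>
        curvature nabla X Y Z = 0)"

definition einstein ::
  "('m, 'e::euclidean_space) chart set \<Rightarrow> ('m \<Rightarrow> 'm tangent \<Rightarrow> 'm tangent \<Rightarrow> real) \<Rightarrow>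
   ('m vfield \<Rightarrow> 'm vfield \<Rightarrow> 'm vfield) \<Rightarrow> bool" where
  "einstein A g nabla \<longleftrightarrow>
     (\<exists>a. smooth_function A a \<and>
        (\<forall>X Y p. vector_field A X \<longrightarrow> vector_field A Y \<longrightarrow>
           ricci A g nabla X Y p = a p * g p (X p) (Y p)))"


section \<open>Contact metric manifolds\<close>

definition d_one_form ::
  "('m \<Rightarrow> 'm tangent \<Rightarrow> real) \<Rightarrow> 'm vfield \<Rightarrow> 'm vfield \<Rightarrow> 'm \<Rightarrow> real" where
  "d_one_form \<eta> X Y p =
     (X p (\<lambda>q. \<eta> q (Y q)) - Y p (\<lambda>q. \<eta> q (X q)) - \<eta> p (lie_bracket X Y p)) / 2"

definition contact_metric_manifold ::
  "('m::{second_countable_topology, t2_space}, 'e::euclidean_space) chart set \<Rightarrow> nat \<Rightarrow>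
   ('m \<Rightarrow> 'm tangent \<Rightarrow> 'm tangent) \<Rightarrow> 'm vfield \<Rightarrow> ('m \<Rightarrow> 'm tangent \<Rightarrow> real) \<Rightarrow>
   ('m \<Rightarrow> 'm tangent \<Rightarrow> 'm tangent \<Rightarrow> real) \<Rightarrow> bool" where
  "contact_metric_manifold A n \<phi> \<xi> \<eta> g \<longleftrightarrow>
     smooth_manifold A \<and> n \<ge> 1 \<and> DIM('e) = 2 * n + 1 \<and>
     tensor_field_1_1 A \<phi> \<and> vector_field A \<xi> \<and> one_form A \<eta> \<and> riemannian_metric A g \<and>
     (\<forall>p. \<forall>v\<in>tangent_space A p. \<phi> p (\<phi> p v) = - v + \<eta> p v *\<^sub>R \<xi> p) \<and>
     (\<forall>p. \<eta> p (\<xi> p) = 1) \<and>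
     (\<forall>p. \<phi> p (\<xi> p) = 0) \<and>
     (\<forall>p. \<forall>v\<in>tangent_space A p. \<eta> p (\<phi> p v) = 0) \<and>
     (\<forall>X Y p. vector_field A X \<longrightarrow> vector_field A Y \<longrightarrow>
        g p (X p) (Y p) = g p (\<phi> p (X p)) (\<phi> p (Y p)) + \<eta> p (X p) * \<eta> p (Y p) \<and>
        g p (X p) (\<phi> p (Y p)) = d_one_form \<eta> X Y p)"

text \<open>
  Here, as in \<open>ricci\<close>, \<open>flat\<close>, \<open>einstein\<close> and \<open>hessian\<close>, \<open>nabla\<close> is meant to be the Levi-Civita connection
  of \<open>g\<close>.
\<close>

definition Nk_contact_metric_manifold ::
  "('m::{second_countable_topology, t2_space}, 'e::euclidean_space) chart set \<Rightarrow> nat \<Rightarrow>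
   ('m \<Rightarrow> 'm tangent \<Rightarrow> 'm tangent) \<Rightarrow> 'm vfield \<Rightarrow> ('m \<Rightarrow> 'm tangent \<Rightarrow> real) \<Rightarrow>
   ('m \<Rightarrow> 'm tangent \<Rightarrow> 'm tangent \<Rightarrow> real) \<Rightarrow>
   ('m vfield \<Rightarrow> 'm vfield \<Rightarrow> 'm vfield) \<Rightarrow> real \<Rightarrow> bool" where
  "Nk_contact_metric_manifold A n \<phi> \<xi> \<eta> g nabla k \<longleftrightarrow>
     contact_metric_manifold A n \<phi> \<xi> \<eta> g \<and>
     (\<forall>X Y. vector_field A X \<longrightarrow> vector_field A Y \<longrightarrow>
        curvature nabla X Y \<xi> = (\<lambda>p. k *\<^sub>R (\<eta> p (Y p) *\<^sub>R X p - \<eta> p (X p) *\<^sub>R Y p)))"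

definition nijenhuis :: "('m \<Rightarrow> 'm tangent \<Rightarrow> 'm tangent) \<Rightarrow> 'm vfield \<Rightarrow> 'm vfield \<Rightarrow> 'm vfield" where
  "nijenhuis \<phi> X Y =
     (let \<Phi> = (\<lambda>Z p. \<phi> p (Z p))
      in \<Phi> (\<Phi> (lie_bracket X Y)) + lie_bracket (\<Phi> X) (\<Phi> Y)
         - \<Phi> (lie_bracket (\<Phi> X) Y) - \<Phi> (lie_bracket X (\<Phi> Y)))"

definition sasakian ::
  "('m::{second_countable_topology, t2_space}, 'e::euclidean_space) chart set \<Rightarrow> nat \<Rightarrow>
   ('m \<Rightarrow> 'm tangent \<Rightarrow> 'm tangent) \<Rightarrow> 'm vfield \<Rightarrow> ('m \<Rightarrow> 'm tangent \<Rightarrow> real) \<Rightarrow>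
   ('m \<Rightarrow> 'm tangent \<Rightarrow> 'm tangent \<Rightarrow> real) \<Rightarrow> bool" where
  "sasakian A n \<phi> \<xi> \<eta> g \<longleftrightarrow>
     contact_metric_manifold A n \<phi> \<xi> \<eta> g \<and>
     (\<forall>X Y p. vector_field A X \<longrightarrow> vector_field A Y \<longrightarrow>
        nijenhuis \<phi> X Y p + (2 * d_one_form \<eta> X Y p) *\<^sub>R \<xi> p = 0)"


section \<open>Gradient Ricci solitons\<close>

definition is_gradient ::
  "('m, 'e::euclidean_space) chart set \<Rightarrow> ('m \<Rightarrow> 'm tangent \<Rightarrow> 'm tangent \<Rightarrow> real) \<Rightarrow>
   ('m \<Rightarrow> real) \<Rightarrow> 'm vfield \<Rightarrow> bool" where
  "is_gradient A g f D \<longleftrightarrow>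
     vector_field A D \<and>
     (\<forall>X p. vector_field A X \<longrightarrow> g p (D p) (X p) = X p f)"

definition hessian ::
  "('m vfield \<Rightarrow> 'm vfield \<Rightarrow> 'm vfield) \<Rightarrow> ('m \<Rightarrow> real) \<Rightarrow> 'm vfield \<Rightarrow> 'm vfield \<Rightarrow> 'm \<Rightarrow> real" where
  "hessian nabla f X Y p = X p (\<lambda>q. Y q f) - nabla X Y p f"

text \<open>The soliton is shrinking, steady or expanding if \<open>lam\<close> is negative, zero or positive.\<close>

definition gradient_ricci_soliton ::
  "('m, 'e::euclidean_space) chart set \<Rightarrow> ('m \<Rightarrow> 'm tangent \<Rightarrow> 'm tangent \<Rightarrow> real) \<Rightarrow>
   ('m vfield \<Rightarrow> 'm vfield \<Rightarrow> 'm vfield) \<Rightarrow> ('m \<Rightarrow> real) \<Rightarrow> real \<Rightarrow> bool" where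
  "gradient_ricci_soliton A g nabla f lam \<longleftrightarrow>
     smooth_function A f \<and>
     (\<forall>X Y p. vector_field A X \<longrightarrow> vector_field A Y \<longrightarrow>
        hessian nabla f X Y p = ricci A g nabla X Y p + lam * g p (X p) (Y p))"

end

(*
  Let T X = nabla_X xi.

  If k is nonzero, then g(R(xi, Y) Df, xi) vanishes by the soliton equation and Ric(., xi) = 2nk eta;
  nullity then gives Df = (xi f) xi. Symmetry of the Hessian yields (xi f) d eta = 0, hence Df = 0.

  If k = 0, the Codazzi equation for T together with phi^2 = -I + eta (x) xi shows that T is
  twice a partial isometry with T^2 = 0, and that (nabla_Z T) X = - g(T X, T Z) xi. The initial
  projection P = phi T / 2 is therefore parallel, and
    R(X, Y) Z = g(T Y, T Z) P X - g(T X, T Z) P Y,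
  the curvature of the product of a flat space with an n-sphere of curvature 4. Hence
  Ric = 4(n - 1) g(P ., .), so nabla_X Df = 4(n - 1) P X + lam X and R(X, Y) Df = 0.

  Thus alternative (a) always holds.
*)
theory Submission
  imports Defs
begin

section \<open>Calculus of \<open>C\<^sup>k\<close> functions\<close>

text \<open>In standard notation T = - phi - phi h with h = (1/2) L_xi phi. For k = 0, h^2 is the
  identity on the contact distribution and P projects onto the +1 eigenspace of h; the constant 4 is
  that of g(T X, T Y) = 4 g(P X, Y). The formula for nabla T rests on a symmetry argument:
  g((nabla_Z T) X, W) is symmetric in Z and X by Codazzi, and on the image of P, where T is
  isometric up to a factor, the relevant components are also skew in W and one of the other two. A
  trilinear form with both symmetries is zero, so only the xi-component survives. The formal
  obstacle is that tangent vectors are derivations of global smooth functions and that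
  \<open>ricci\<close> takes its frame by choice. Before a frame sum means anything, orthonormal
  frames of global fields must be shown to exist at each point, and this rests on bump functions and
  Hadamard's lemma. From then on identities are equations between global fields, tested against
  global fields, and frame sums are evaluated by Parseval.\<close>

lemma C_on_Suc_has_derivative:
  "C_on (Suc k) S f \<Longrightarrow> x \<in> S \<Longrightarrow> (f has_derivative frechet_derivative f (at x)) (at x)"
  by (simp add: frechet_derivative_works)

lemma C_on_cong:
  assumes "open S" "\<And>x. x \<in> S \<Longrightarrow> f x = h x" "C_on k S f"
  shows "C_on k S h"
  using assms(2,3)
proof (induction k arbitrary: f h)
  case 0
  then show ?case by (simp cong: continuous_on_cong)
next
  case (Suc k)
  have der: "(h has_derivative frechet_derivative f (at x)) (at x)" if "x \<in> S" for x
    using C_on_Suc_has_derivative[OF Suc.prems(2) that]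
    by (rule has_derivative_transform_within_open[OF _ assms(1) that]) (simp add: Suc.prems(1))
  have "frechet_derivative h (at x) = frechet_derivative f (at x)" if "x \<in> S" for x
    using frechet_derivative_at[OF der[OF that]] by simp
  then have "C_on k S (\<lambda>x. frechet_derivative h (at x) v)" for v
    using Suc.prems(2) by (auto intro: Suc.IH[of "\<lambda>x. frechet_derivative f (at x) v", rotated])
  moreover have "\<forall>x\<in>S. h differentiable (at x)"
    using der by (auto simp: differentiable_def)
  ultimately show ?case by simp
qed

text \<open>Any exhibited family of derivatives may stand in for the chosen
  \<open>frechet_derivative\<close>; the closure rules for sums, products and composites go through
  this rule.\<close>

lemma C_on_intro_Suc:
  assumes "open S" "\<And>x. x \<in> S \<Longrightarrow> (f has_derivative f' x) (at x)" "\<And>v. C_on k S (\<lambda>x. f' x v)"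
  shows "C_on (Suc k) S f"
proof -
  have "frechet_derivative f (at x) = f' x" if "x \<in> S" for x
    using frechet_derivative_at[OF assms(2)[OF that]] by simp
  then have "C_on k S (\<lambda>x. frechet_derivative f (at x) v)" for v
    by (intro C_on_cong[OF assms(1) _ assms(3)[of v]]) simp
  moreover have "\<forall>x\<in>S. f differentiable (at x)"
    using assms(2) by (auto simp: differentiable_def)
  ultimately show ?thesis by simp
qed

lemma C_on_Suc_imp: "C_on (Suc k) S f \<Longrightarrow> C_on k S f"
proof (induction k arbitrary: f)
  case 0
  then show ?case
    by (auto intro!: continuous_at_imp_continuous_on differentiable_imp_continuous_within)
next
  case (Suc k)
  then show ?case by (metis C_on.simps(2))
qed

lemma C_on_imp_continuous_on: "C_on k S f \<Longrightarrow> continuous_on S f"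
  by (cases k) (auto intro!: continuous_at_imp_continuous_on differentiable_imp_continuous_within)

lemma C_on_subset: "C_on k S f \<Longrightarrow> T \<subseteq> S \<Longrightarrow> C_on k T f"
  by (induction k arbitrary: f) (auto intro: continuous_on_subset)

lemma C_on_Un: "open S \<Longrightarrow> open T \<Longrightarrow> C_on k S f \<Longrightarrow> C_on k T f \<Longrightarrow> C_on k (S \<union> T) f"
  by (induction k arbitrary: f) (auto intro: continuous_on_open_Un)

lemma C_on_const: "C_on k S (\<lambda>x. c)"
  by (induction k arbitrary: c) (auto simp: frechet_derivative_const)

lemma C_on_add:
  assumes "open S" "C_on k S f" "C_on k S h"
  shows "C_on k S (\<lambda>x. f x + h x)"
  using assms(2,3)
proof (induction k arbitrary: f h)
  case 0
  then show ?case by (simp add: continuous_on_add)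
next
  case (Suc k)
  show ?case
    by (rule C_on_intro_Suc[OF assms(1) has_derivative_add[OF
        C_on_Suc_has_derivative[OF Suc.prems(1)] C_on_Suc_has_derivative[OF Suc.prems(2)]]])
      (use Suc in auto)
qed

lemma C_on_mult:
  fixes f h :: "'a::euclidean_space \<Rightarrow> real"
  assumes "open S" "C_on k S f" "C_on k S h"
  shows "C_on k S (\<lambda>x. f x * h x)"
  using assms(2,3)
proof (induction k arbitrary: f h)
  case 0
  then show ?case by (simp add: continuous_on_mult)
next
  case (Suc k)
  have "C_on k S (\<lambda>x. f x * frechet_derivative h (at x) v)"
    "C_on k S (\<lambda>x. frechet_derivative f (at x) v * h x)" for v
    using Suc.prems C_on_Suc_imp[OF Suc.prems(1)] C_on_Suc_imp[OF Suc.prems(2)]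
    by (simp_all add: Suc.IH)
  then show ?case
    by (intro C_on_intro_Suc[OF assms(1) has_derivative_mult[OF
          C_on_Suc_has_derivative[OF Suc.prems(1)] C_on_Suc_has_derivative[OF Suc.prems(2)]]]
        C_on_add[OF assms(1)])
qed

lemma C_on_sum:
  assumes "open S" "\<And>i. i \<in> I \<Longrightarrow> C_on k S (f i)"
  shows "C_on k S (\<lambda>x. \<Sum>i\<in>I. f i x)"
  using assms(2) by (induction I rule: infinite_finite_induct) (auto intro!: C_on_const C_on_add[OF assms(1)])

lemma C_on_bounded_linear:
  assumes "open S" "bounded_linear L" "C_on k S f"
  shows "C_on k S (\<lambda>x. L (f x))"
  using assms(3)
proof (induction k arbitrary: f)
  case 0
  then show ?case using assms(2) by (simp add: bounded_linear.continuous_on)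
next
  case (Suc k)
  show ?case
    by (rule C_on_intro_Suc[OF assms(1) bounded_linear.has_derivative[OF assms(2)
        C_on_Suc_has_derivative[OF Suc.prems]]]) (use Suc in auto)
qed

lemma C_on_ident: "open S \<Longrightarrow> C_on k S (\<lambda>x. x)"
  by (cases k) (auto intro!: C_on_intro_Suc[OF _ has_derivative_ident] C_on_const simp del: C_on.simps(2))

lemma C_on_compose:
  fixes f :: "'a::euclidean_space \<Rightarrow> 'b::euclidean_space" and h :: "'b \<Rightarrow> real"
  assumes "open S" "C_on k S f" "C_on k T h" "f ` S \<subseteq> T"
  shows "C_on k S (\<lambda>x. h (f x))"
  using assms(2,3)
proof (induction k arbitrary: h)
  case 0
  then show ?case using continuous_on_compose2[OF _ _ assms(4)] by auto
next
  case (Suc k)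
  \<comment> \<open>\<open>C_on\<close> controls derivatives in a fixed direction only, but the
    chain rule applies the derivative of \<open>h\<close> to the moving vector
    \<open>frechet_derivative f (at x) v\<close>. Expanding that vector in \<open>Basis\<close>
    leaves fixed directions with variable coefficients.\<close>
  let ?D = "\<lambda>x v. \<Sum>b\<in>Basis. (frechet_derivative f (at x) v \<bullet> b) * frechet_derivative h (at (f x)) b"
  have "((\<lambda>x. h (f x)) has_derivative ?D x) (at x)" if x: "x \<in> S" for x
  proof -
    have h: "(h has_derivative frechet_derivative h (at (f x))) (at (f x))"
      using C_on_Suc_has_derivative[OF Suc.prems(2)] assms(4) x by blast
    have lin: "linear (frechet_derivative h (at (f x)))"
      using h has_derivative_linear by blast
    have "frechet_derivative h (at (f x)) w = (\<Sum>b\<in>Basis. (w \<bullet> b) * frechet_derivative h (at (f x)) b)" for w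
    proof -
      have "frechet_derivative h (at (f x)) w = frechet_derivative h (at (f x)) (\<Sum>b\<in>Basis. (w \<bullet> b) *\<^sub>R b)"
        by (simp add: euclidean_representation)
      also have "\<dots> = (\<Sum>b\<in>Basis. (w \<bullet> b) * frechet_derivative h (at (f x)) b)"
        by (simp add: linear_sum[OF lin] linear_scale[OF lin])
      finally show ?thesis .
    qed
    then have "frechet_derivative h (at (f x)) \<circ> frechet_derivative f (at x) = ?D x"
      unfolding o_def by blast
    then show ?thesis
      using diff_chain_at[OF C_on_Suc_has_derivative[OF Suc.prems(1) x] h] by (simp add: o_def)
  qed
  moreover have "C_on k S (\<lambda>x. ?D x v)" for v
  proof (intro C_on_sum C_on_mult assms(1))
    fix b :: 'b
    show "C_on k S (\<lambda>x. frechet_derivative f (at x) v \<bullet> b)"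
      using Suc.prems(1) by (intro C_on_bounded_linear[OF assms(1) bounded_linear_inner_left]) simp
    show "C_on k S (\<lambda>x. frechet_derivative h (at (f x)) b)"
      using Suc.prems(2) by (intro Suc.IH[OF C_on_Suc_imp[OF Suc.prems(1)]]) simp
  qed
  ultimately show ?case by (rule C_on_intro_Suc[OF assms(1)])
qed

section \<open>Smooth bump functions\<close>

definition flat_exp :: "nat \<Rightarrow> real \<Rightarrow> real" where
  "flat_exp j t = (if t > 0 then exp (- 1 / t) / t ^ j else 0)"

text \<open>Substituting s = 1/t turns the right limit into that of s^j / exp s at infinity.\<close>

lemma flat_exp_tendsto_0: "(flat_exp j \<longlongrightarrow> 0) (at 0)"
proof -
  have "((\<lambda>s::real. s ^ j / exp s) \<longlongrightarrow> 0) at_top"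
    by (rule tendsto_power_div_exp_0)
  then have "((\<lambda>t::real. inverse t ^ j / exp (inverse t)) \<longlongrightarrow> 0) (at_right 0)"
    by (rule filterlim_compose[OF _ filterlim_inverse_at_top_right])
  then have "(flat_exp j \<longlongrightarrow> 0) (at_right 0)"
    by (rule Lim_transform_eventually)
      (auto simp: eventually_at_filter flat_exp_def exp_minus field_simps)
  moreover have "(flat_exp j \<longlongrightarrow> 0) (at_left 0)"
    by (rule Lim_transform_eventually[OF tendsto_const])
      (auto simp: eventually_at_filter flat_exp_def)
  ultimately show ?thesis by (simp add: filterlim_at_split)
qed

text \<open>The powers of t in the denominator make the family closed under differentiation, so that
  one induction over all members proves smoothness.\<close>

lemma flat_exp_derivative:
  "(flat_exp j has_real_derivative flat_exp (j + 2) t - real j * flat_exp (j + 1) t) (at t)"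
proof -
  consider "t > 0" | "t < 0" | "t = 0" by linarith
  then show ?thesis
  proof cases
    case 1
    \<comment> \<open>For \<open>j = 0\<close> the exponent \<open>j - 1\<close> is truncated to 0;
      the factor \<open>real j\<close> keeps the identity true there.\<close>
    have pow: "real j * t ^ (j - 1) * t = real j * t ^ j"
      by (cases j) auto
    have "((\<lambda>t. exp (- 1 / t) / t ^ j) has_real_derivative
        (exp (- 1 / t) * (1 / (t * t)) * t ^ j - exp (- 1 / t) * (real j * t ^ (j - 1))) / (t ^ j * t ^ j)) (at t)"
      using 1 by (auto intro!: derivative_eq_intros)
    also have "(exp (- 1 / t) * (1 / (t * t)) * t ^ j - exp (- 1 / t) * (real j * t ^ (j - 1))) / (t ^ j * t ^ j) =
        (exp (- 1 / t) * (1 / (t * t)) * t ^ j * t - exp (- 1 / t) * (real j * t ^ (j - 1) * t)) / (t ^ j * t ^ j * t)"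
      using 1 by (simp add: divide_simps)
    also have "\<dots> = flat_exp (j + 2) t - real j * flat_exp (j + 1) t"
      unfolding pow using 1 by (simp add: flat_exp_def divide_simps) (simp add: algebra_simps)
    finally have "((\<lambda>t. exp (- 1 / t) / t ^ j) has_real_derivative
        flat_exp (j + 2) t - real j * flat_exp (j + 1) t) (at t)" .
    then show ?thesis
      by (rule has_field_derivative_transform_within_open[of _ _ _ "{0<..}"])
        (use 1 in \<open>auto simp: flat_exp_def\<close>)
  next
    case 2
    have "((\<lambda>t. 0) has_real_derivative flat_exp (j + 2) t - real j * flat_exp (j + 1) t) (at t)"
      using 2 by (auto simp: flat_exp_def)
    then show ?thesis
      by (rule has_field_derivative_transform_within_open[of _ _ _ "{..<0}"])
        (use 2 in \<open>auto simp: flat_exp_def\<close>)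
  next
    case 3
    \<comment> \<open>The difference quotient of \<open>flat_exp j\<close> at 0 is
      \<open>flat_exp (Suc j)\<close>.\<close>
    have "((\<lambda>h. (flat_exp j (0 + h) - flat_exp j 0) / h) \<longlongrightarrow> 0) (at 0)"
      by (rule Lim_transform_eventually[OF flat_exp_tendsto_0[of "Suc j"]])
        (auto simp: eventually_at_filter flat_exp_def)
    then have "(flat_exp j has_real_derivative 0) (at 0)"
      by (simp add: DERIV_def)
    then show ?thesis using 3 by (simp add: flat_exp_def)
  qed
qed

lemma C_on_flat_exp: "C_on k UNIV (flat_exp j)"
proof (induction k arbitrary: j)
  case 0
  show ?case
    using flat_exp_derivative by (auto intro!: continuous_at_imp_continuous_on DERIV_isCont)
next
  case (Suc k)
  have "C_on k UNIV (\<lambda>x. flat_exp (j + 2) x + (- real j) * flat_exp (j + 1) x)"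
    by (intro C_on_add C_on_mult C_on_const Suc open_UNIV)
  then have "C_on k UNIV (\<lambda>x. (flat_exp (j + 2) x - real j * flat_exp (j + 1) x) * v)" for v
    by (intro C_on_mult C_on_const open_UNIV) simp
  then show ?case
    by (intro C_on_intro_Suc[OF open_UNIV flat_exp_derivative[unfolded has_field_derivative_def]])
qed

lemma bump_function:
  fixes a :: "'a::euclidean_space" and r :: real
  assumes "r > 0"
  obtains \<psi> :: "'a \<Rightarrow> real" where "smooth_on UNIV \<psi>" "\<psi> a = 1" "\<And>x. x \<notin> cball a r \<Longrightarrow> \<psi> x = 0"
proof
  \<comment> \<open>The argument is r^2 - |x - a|^2, positive exactly on the open ball; the last
    factor normalises the value at \<open>a\<close>. Everything is spelled in the shapes of the
    closure rules of \<open>C_on\<close>.\<close>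
  let ?\<psi> = "\<lambda>x. flat_exp 0 (r\<^sup>2 + (- 1) * ((\<Sum>b\<in>Basis. ((x + - a) \<bullet> b) * ((x + - a) \<bullet> b)))) * (1 / flat_exp 0 (r\<^sup>2))"
  have eq: "(\<Sum>b\<in>Basis. ((x + - a) \<bullet> b) * ((x + - a) \<bullet> b)) = (norm (x - a))\<^sup>2" for x
    using euclidean_inner[of "x - a" "x - a"] by (simp add: power2_norm_eq_inner)
  show "smooth_on UNIV ?\<psi>"
    unfolding smooth_on_def
  proof
    fix k
    have "C_on k UNIV (\<lambda>x. (x + - a) \<bullet> b)" for b
      by (intro C_on_bounded_linear[OF open_UNIV bounded_linear_inner_left] C_on_add open_UNIV
          C_on_ident C_on_const)
    then have "C_on k UNIV (\<lambda>x. \<Sum>b\<in>Basis. ((x + - a) \<bullet> b) * ((x + - a) \<bullet> b))"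
      by (intro C_on_sum C_on_mult open_UNIV)
    then have q: "C_on k UNIV (\<lambda>x. r\<^sup>2 + (- 1) * (\<Sum>b\<in>Basis. ((x + - a) \<bullet> b) * ((x + - a) \<bullet> b)))"
      by (intro C_on_add[OF open_UNIV C_on_const] C_on_mult[OF open_UNIV C_on_const])
    show "C_on k UNIV ?\<psi>"
      by (rule C_on_mult[OF open_UNIV C_on_compose[OF open_UNIV q C_on_flat_exp subset_UNIV] C_on_const])
  qed
  show "?\<psi> a = 1" using assms by (simp add: flat_exp_def)
  fix x assume "x \<notin> cball a r"
  then have "r < norm (x - a)" by (simp add: dist_norm norm_minus_commute)
  then have "r\<^sup>2 \<le> (norm (x - a))\<^sup>2" using assms by (intro power_mono) auto
  then show "?\<psi> x = 0" unfolding eq by (simp add: flat_exp_def)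
qed

section \<open>Hadamard's lemma\<close>

lemma C_on_segment_integral:
  fixes h :: "'a::euclidean_space \<Rightarrow> real"
  assumes S: "open S" "convex S" "a \<in> S" and "C_on k S h"
  shows "C_on k S (\<lambda>x. integral {0..1} (\<lambda>t. t ^ j * h (a + t *\<^sub>R (x - a))))"
proof -
  have seg: "a + t *\<^sub>R (x - a) \<in> S" if "x \<in> S" "t \<in> {0..1}" for x and t :: real
    using convexD_alt[OF S(2,3) that(1), of t] that(2) by (simp add: algebra_simps)
  have cont: "continuous_on (S \<times> {0..1}) (\<lambda>(x, t). t ^ j * h (a + t *\<^sub>R (x - a)))"
    if "continuous_on S h" for h :: "'a \<Rightarrow> real" and j :: nat
    unfolding split_beta
    by (intro continuous_intros continuous_on_compose2[OF that]) (auto simp: seg)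
  show ?thesis
    using assms(4)
  proof (induction k arbitrary: h j)
    case 0
    then show ?case
      using integral_continuous_on_param[of S 0 1 "\<lambda>x t. t ^ j * h (a + t *\<^sub>R (x - a))"] cont
      by simp
  next
    case (Suc k)
    have hc: "continuous_on S h"
      using Suc.prems by (rule C_on_imp_continuous_on)
    \<comment> \<open>\<open>leibniz_rule\<close> takes the derivative in \<open>x\<close> as a
      bounded linear map. The chain rule along the segment contributes one more factor
      \<open>t\<close>, which is why the weight \<open>t ^ j\<close> is general in the
      induction.\<close>
    define F where "F x t = Blinfun (\<lambda>v. t ^ (Suc j) * frechet_derivative h (at (a + t *\<^sub>R (x - a))) v)"
      for x and t :: real
    have F: "blinfun_apply (F x t) = (\<lambda>v. t ^ (Suc j) * frechet_derivative h (at (a + t *\<^sub>R (x - a))) v)"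
      if "x \<in> S" "t \<in> {0..1}" for x t
      unfolding F_def
      by (intro bounded_linear_Blinfun_apply bounded_linear_const_mult
          has_derivative_bounded_linear[OF C_on_Suc_has_derivative[OF Suc.prems seg[OF that]]])
    have Dc: "C_on k S (\<lambda>y. frechet_derivative h (at y) v)" for v
      using Suc.prems by simp
    have Dcont: "continuous_on S (\<lambda>y. frechet_derivative h (at y) v)" for v
      using Dc[of v] by (rule C_on_imp_continuous_on)
    have Fc: "continuous_on (S \<times> cbox 0 1) (\<lambda>(x, t). F x t)"
    proof (rule continuous_on_blinfun_componentwise)
      fix i :: 'a
      have "continuous_on (S \<times> {0..1}) (\<lambda>(x, t). t ^ (Suc j) * frechet_derivative h (at (a + t *\<^sub>R (x - a))) i)"
        by (rule cont[OF Dcont])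
      then show "continuous_on (S \<times> cbox 0 1) (\<lambda>x. blinfun_apply (case x of (x, t) \<Rightarrow> F x t) i)"
        by (rule continuous_on_cong[THEN iffD1, rotated 2]) (auto simp: F)
    qed
    have int: "(\<lambda>t. t ^ j * h (a + t *\<^sub>R (x - a))) integrable_on cbox 0 1" if "x \<in> S" for x
      using that by (intro integrable_continuous continuous_intros continuous_on_compose2[OF hc]) (auto simp: seg)
    have der: "((\<lambda>x. integral (cbox 0 1) (\<lambda>t. t ^ j * h (a + t *\<^sub>R (x - a)))) has_derivative
        blinfun_apply (integral (cbox 0 1) (F x))) (at x)" if x: "x \<in> S" for x
    proof -
      have "((\<lambda>x. t ^ j * h (a + t *\<^sub>R (x - a))) has_derivative blinfun_apply (F y t)) (at y within S)"
        if "y \<in> S" "t \<in> cbox 0 1" for y t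
      proof -
        have t: "t \<in> {0..1}" using that(2) by simp
        have "((\<lambda>x. a + t *\<^sub>R (x - a)) has_derivative (\<lambda>v. t *\<^sub>R v)) (at y)"
          by (auto intro!: derivative_eq_intros)
        from diff_chain_at[OF this C_on_Suc_has_derivative[OF Suc.prems seg[OF that(1) t]]]
        have d: "((\<lambda>x. h (a + t *\<^sub>R (x - a))) has_derivative
            (\<lambda>v. frechet_derivative h (at (a + t *\<^sub>R (y - a))) (t *\<^sub>R v))) (at y)"
          by (simp add: o_def)
        have lin: "linear (frechet_derivative h (at (a + t *\<^sub>R (y - a))))"
          using C_on_Suc_has_derivative[OF Suc.prems seg[OF that(1) t]] has_derivative_linear by blast
        show ?thesis
          unfolding F[OF that(1) t] 
          by (rule has_derivative_eq_rhs[OF has_derivative_at_withinI[OF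
                has_derivative_mult_right[OF d, of "t ^ j"]]])
            (simp add: linear_scale[OF lin] fun_eq_iff)
      qed
      from leibniz_rule[where f = "\<lambda>x t. t ^ j * h (a + t *\<^sub>R (x - a))", OF this int Fc x S(2)]
      show ?thesis unfolding at_within_open[OF x S(1)] .
    qed
    have ev: "blinfun_apply (integral (cbox 0 1) (F x)) v =
        integral {0..1} (\<lambda>t. t ^ (Suc j) * frechet_derivative h (at (a + t *\<^sub>R (x - a))) v)"
      if x: "x \<in> S" for x v
    proof -
      have "F x integrable_on cbox 0 1"
        using x by (intro integrable_continuous continuous_on_compose2[OF Fc, of _ "\<lambda>t. (x, t)", simplified] continuous_intros) auto
      then have "blinfun_apply (integral (cbox 0 1) (F x)) v = integral (cbox 0 1) (\<lambda>t. blinfun_apply (F x t) v)"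
        by (rule blinfun_apply_integral)
      also have "\<dots> = integral {0..1} (\<lambda>t. t ^ (Suc j) * frechet_derivative h (at (a + t *\<^sub>R (x - a))) v)"
        unfolding cbox_interval by (intro integral_cong) (simp add: F x)
      finally show ?thesis .
    qed
    have "C_on k S (\<lambda>x. blinfun_apply (integral (cbox 0 1) (F x)) v)" for v
      by (rule C_on_cong[OF S(1) _ Suc.IH[OF Dc[of v], of "Suc j"]]) (simp only: ev)
    then show ?case
      using C_on_intro_Suc[OF S(1) der, of k] by (simp add: cbox_interval)
  qed
qed

text \<open>Integrate the derivative of \<open>f\<close> along the segment from \<open>a\<close> to
  \<open>x\<close>; the coefficients are the integrals of the partial derivatives, with weight
  \<open>t ^ 0\<close>.\<close>

lemma hadamard:
  fixes f :: "'a::euclidean_space \<Rightarrow> real"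
  assumes S: "open S" "convex S" "a \<in> S" and f: "smooth_on S f"
  obtains G where "\<And>b. smooth_on S (G b)" "\<And>b. G b a = frechet_derivative f (at a) b"
    "\<And>x. x \<in> S \<Longrightarrow> f x = f a + (\<Sum>b\<in>Basis. ((x - a) \<bullet> b) * G b x)"
proof
  let ?G = "\<lambda>b x. integral {0..1} (\<lambda>t. t ^ 0 * frechet_derivative f (at (a + t *\<^sub>R (x - a))) b)"
  have Dc: "C_on k S (\<lambda>y. frechet_derivative f (at y) b)" for b k
    using f unfolding smooth_on_def by (metis C_on.simps(2))
  have der: "(f has_derivative frechet_derivative f (at x)) (at x)" if "x \<in> S" for x
    using f that C_on_Suc_has_derivative unfolding smooth_on_def by blast
  show "smooth_on S (?G b)" for b
    unfolding smooth_on_def using C_on_segment_integral[OF S Dc] by blast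
  show "?G b a = frechet_derivative f (at a) b" for b by simp
  fix x assume x: "x \<in> S"
  have seg: "a + t *\<^sub>R (x - a) \<in> S" if "t \<in> {0..1}" for t :: real
    using convexD_alt[OF S(2,3) x, of t] that by (simp add: algebra_simps)
  have cont: "continuous_on {0..1} (\<lambda>t. frechet_derivative f (at (a + t *\<^sub>R (x - a))) b)" for b
    by (rule continuous_on_compose2[OF C_on_imp_continuous_on[OF Dc[of 0 b]]])
      (auto intro!: continuous_intros simp: seg)
  have "((\<lambda>t. frechet_derivative f (at (a + t *\<^sub>R (x - a))) (x - a)) has_integral
      f (a + 1 *\<^sub>R (x - a)) - f (a + 0 *\<^sub>R (x - a))) {0..1}"
  proof (rule fundamental_theorem_of_calculus)
    fix t :: real assume t: "t \<in> {0..1}"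
    have "((\<lambda>t. a + t *\<^sub>R (x - a)) has_derivative (\<lambda>s. s *\<^sub>R (x - a))) (at t)"
      by (auto intro!: derivative_eq_intros)
    from diff_chain_at[OF this der[OF seg[OF t]]]
    have "((\<lambda>t. f (a + t *\<^sub>R (x - a))) has_derivative
       (\<lambda>s. frechet_derivative f (at (a + t *\<^sub>R (x - a))) (s *\<^sub>R (x - a)))) (at t)"
      by (simp add: o_def)
    moreover have lin: "linear (frechet_derivative f (at (a + t *\<^sub>R (x - a))))"
      using der[OF seg[OF t]] has_derivative_linear by blast
    ultimately show "((\<lambda>t. f (a + t *\<^sub>R (x - a))) has_vector_derivative
        frechet_derivative f (at (a + t *\<^sub>R (x - a))) (x - a)) (at t within {0..1})"
      unfolding has_vector_derivative_def
      by (auto intro: has_derivative_at_withinI simp only: linear_scale[OF lin])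
  qed simp
  then have "f x - f a = integral {0..1} (\<lambda>t. frechet_derivative f (at (a + t *\<^sub>R (x - a))) (x - a))"
    by (simp add: integral_unique)
  also have "\<dots> = integral {0..1} (\<lambda>t. \<Sum>b\<in>Basis. ((x - a) \<bullet> b) * frechet_derivative f (at (a + t *\<^sub>R (x - a))) b)"
  proof (rule integral_cong)
    fix t :: real assume t: "t \<in> {0..1}"
    have lin: "linear (frechet_derivative f (at (a + t *\<^sub>R (x - a))))"
      using der[OF seg[OF t]] has_derivative_linear by blast
    have "frechet_derivative f (at (a + t *\<^sub>R (x - a))) (x - a) =
        frechet_derivative f (at (a + t *\<^sub>R (x - a))) (\<Sum>b\<in>Basis. ((x - a) \<bullet> b) *\<^sub>R b)"
      by (simp only: euclidean_representation)
    also have "\<dots> = (\<Sum>b\<in>Basis. ((x - a) \<bullet> b) * frechet_derivative f (at (a + t *\<^sub>R (x - a))) b)"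
      by (simp only: linear_sum[OF lin] linear_scale[OF lin] real_scaleR_def)
    finally show "frechet_derivative f (at (a + t *\<^sub>R (x - a))) (x - a) =
      (\<Sum>b\<in>Basis. ((x - a) \<bullet> b) * frechet_derivative f (at (a + t *\<^sub>R (x - a))) b)" .
  qed
  also have "\<dots> = (\<Sum>b\<in>Basis. ((x - a) \<bullet> b) * ?G b x)"
    by (subst integral_sum) (auto intro!: integrable_continuous_real continuous_intros cont)
  finally show "f x = f a + (\<Sum>b\<in>Basis. ((x - a) \<bullet> b) * ?G b x)" by simp
qed

section \<open>Global vector fields and orthonormal frames\<close>

locale atlas =
  fixes A :: "('m::{second_countable_topology, t2_space}, 'e::euclidean_space) chart set"
  assumes smooth_manifold: "smooth_manifold A"
begin

lemma atlas_chart: "(U, c) \<in> A \<Longrightarrow> chart U c"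
  using smooth_manifold by (auto simp: smooth_manifold_def)

lemma
  assumes "(U, c) \<in> A"
  shows chart_open: "open U"
    and chart_image_open: "open (c ` U)"
    and chart_homeomorphism: "homeomorphism U (c ` U) c (inv_into U c)"
    and chart_inv: "q \<in> U \<Longrightarrow> inv_into U c (c q) = q"
    and chart_inv_in: "x \<in> c ` U \<Longrightarrow> inv_into U c x \<in> U"
    and chart_f_inv: "x \<in> c ` U \<Longrightarrow> c (inv_into U c x) = x"
  using atlas_chart[OF assms] by (auto simp: chart_def homeomorphism_def)

lemma chart_transition:
  assumes "(U, c) \<in> A" "(V, d) \<in> A"
  shows "smooth_on (c ` (U \<inter> V)) (d \<circ> inv_into U c)"
proof -
  have "\<forall>(U, c)\<in>A. \<forall>(V, d)\<in>A. smooth_on (c ` (U \<inter> V)) (d \<circ> inv_into U c)"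
    using smooth_manifold unfolding smooth_manifold_def by (elim conjE)
  from bspec[OF bspec[OF this assms(1), unfolded split] assms(2)] show ?thesis by simp
qed

lemma chart_exists:
  obtains U c where "(U, c) \<in> A" "p \<in> U"
proof -
  have "p \<in> (\<Union>(U, c)\<in>A. U)"
    using smooth_manifold unfolding smooth_manifold_def by blast
  then show ?thesis using that by blast
qed

lemma chart_image_open_subset:
  assumes "(U, c) \<in> A" "open V" "V \<subseteq> U"
  shows "open (c ` V)"
proof -
  have "openin (top_of_set (c ` U)) (c ` V)"
    using homeomorphism_imp_open_map[OF chart_homeomorphism[OF assms(1)], of V] assms
    by (simp add: openin_open_eq chart_open)
  then show ?thesis
    using openin_open_trans chart_image_open[OF assms(1)] by blast
qed

lemma smooth_function_iff:
  "smooth_function A f \<longleftrightarrow> (\<forall>(U, c)\<in>A. \<forall>k. C_on k (c ` U) (\<lambda>x. f (inv_into U c x)))"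
  by (simp add: smooth_function_def smooth_on_def o_def)

lemma smooth_function_const: "smooth_function A (\<lambda>q. a)"
  by (auto simp: smooth_function_iff C_on_const)

lemma smooth_function_add:
  "smooth_function A f \<Longrightarrow> smooth_function A h \<Longrightarrow> smooth_function A (\<lambda>q. f q + h q)"
  by (auto simp: smooth_function_iff intro!: C_on_add chart_image_open)

lemma smooth_function_mult:
  "smooth_function A f \<Longrightarrow> smooth_function A h \<Longrightarrow> smooth_function A (\<lambda>q. f q * h q)"
  by (auto simp: smooth_function_iff intro!: C_on_mult chart_image_open)

lemma smooth_function_minus: "smooth_function A f \<Longrightarrow> smooth_function A (\<lambda>q. - f q)"
  using smooth_function_mult[OF smooth_function_const[of "-1"]] by simp

lemma smooth_function_diff:
  "smooth_function A f \<Longrightarrow> smooth_function A h \<Longrightarrow> smooth_function A (\<lambda>q. f q - h q)"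
  using smooth_function_add[OF _ smooth_function_minus] by simp

lemma smooth_function_sum:
  "(\<And>i. i \<in> I \<Longrightarrow> smooth_function A (f i)) \<Longrightarrow> smooth_function A (\<lambda>q. \<Sum>i\<in>I. f i q)"
  by (induction I rule: infinite_finite_induct) (auto intro!: smooth_function_const smooth_function_add)

text \<open>The preimage of \<open>K\<close> is compact, hence closed in a Hausdorff space. So each
  chart domain is covered by two open sets: on one the function vanishes, on the other it is given
  by \<open>F\<close>.\<close>

lemma smooth_function_extension:
  assumes Uc: "(U, c) \<in> A" and F: "smooth_on (c ` U) F"
    and K: "compact K" "K \<subseteq> c ` U" "\<And>x. x \<in> c ` U \<Longrightarrow> x \<notin> K \<Longrightarrow> F x = 0"
  shows "smooth_function A (\<lambda>q. if q \<in> U then F (c q) else 0)"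
  unfolding smooth_function_iff
proof safe
  fix V d k assume Vd: "(V, d) \<in> A"
  let ?f = "\<lambda>q. if q \<in> U then F (c q) else 0"
  let ?K = "inv_into U c ` K"
  have "continuous_on K (inv_into U c)"
    using chart_homeomorphism[OF Uc] K(2) by (auto simp: homeomorphism_def intro: continuous_on_subset)
  then have "closed ?K"
    using K(1) compact_continuous_image compact_imp_closed by blast
  then have oV: "open (d ` (V - ?K))" "open (d ` (U \<inter> V))"
    using chart_image_open_subset[OF Vd] chart_open[OF Vd] chart_open[OF Uc] by auto
  have zero: "?f q = 0" if "q \<notin> ?K" for q
    using that K(3) chart_inv[OF Uc] by (metis imageI)
  have 1: "C_on k (d ` (V - ?K)) (\<lambda>x. ?f (inv_into V d x))"
  proof (rule C_on_cong[OF oV(1) _ C_on_const[of _ _ 0]])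
    fix x assume "x \<in> d ` (V - ?K)"
    then have "inv_into V d x \<notin> ?K" using chart_inv[OF Vd] by auto
    then show "0 = ?f (inv_into V d x)" by (rule zero[symmetric])
  qed
  have "C_on k (d ` (V \<inter> U)) (\<lambda>x. (c \<circ> inv_into V d) x)"
    using chart_transition[OF Vd Uc] by (simp add: smooth_on_def o_def)
  then have "C_on k (d ` (U \<inter> V)) (\<lambda>x. F ((c \<circ> inv_into V d) x))"
    using F chart_inv[OF Vd]
    by (intro C_on_compose[OF oV(2), where T = "c ` U"]) (auto simp: smooth_on_def Int_commute)
  then have 2: "C_on k (d ` (U \<inter> V)) (\<lambda>x. ?f (inv_into V d x))"
    by (rule C_on_cong[OF oV(2), rotated]) (use chart_inv[OF Vd] in auto)
  have "(V - ?K) \<union> (U \<inter> V) = V"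
    using chart_inv_in[OF Uc] K(2) by auto
  then have "d ` (V - ?K) \<union> d ` (U \<inter> V) = d ` V"
    by (metis image_Un)
  then show "C_on k (d ` V) (\<lambda>x. ?f (inv_into V d x))"
    using C_on_Un[OF oV 1 2] by simp
qed

lemma
  assumes "v \<in> tangent_space A p"
  shows tangent_add: "smooth_function A f \<Longrightarrow> smooth_function A h \<Longrightarrow> v (\<lambda>q. f q + h q) = v f + v h"
    and tangent_cmult: "smooth_function A f \<Longrightarrow> v (\<lambda>q. a * f q) = a * v f"
    and tangent_diff: "smooth_function A f \<Longrightarrow> smooth_function A h \<Longrightarrow> v (\<lambda>q. f q - h q) = v f - v h"
    and tangent_mult: "smooth_function A f \<Longrightarrow> smooth_function A h \<Longrightarrow>
      v (\<lambda>q. f q * h q) = f p * v h + h p * v f"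
    and tangent_not_smooth: "\<not> smooth_function A f \<Longrightarrow> v f = 0"
    and tangent_const: "v (\<lambda>q. a) = 0"
proof -
  have lin: "smooth_function A f \<Longrightarrow> smooth_function A h \<Longrightarrow> v (\<lambda>q. a * f q + b * h q) = a * v f + b * v h"
    for f h a b using assms by (simp add: tangent_space_def)
  show mult: "smooth_function A f \<Longrightarrow> smooth_function A h \<Longrightarrow>
      v (\<lambda>q. f q * h q) = f p * v h + h p * v f" for f h
    using assms by (simp add: tangent_space_def)
  show "\<not> smooth_function A f \<Longrightarrow> v f = 0"
    using assms by (simp add: tangent_space_def)
  show "smooth_function A f \<Longrightarrow> smooth_function A h \<Longrightarrow> v (\<lambda>q. f q + h q) = v f + v h"
    using lin[of f h 1 1] by simp
  show "smooth_function A f \<Longrightarrow> smooth_function A h \<Longrightarrow> v (\<lambda>q. f q - h q) = v f - v h"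
    using lin[of f h 1 "-1"] by simp
  show "smooth_function A f \<Longrightarrow> v (\<lambda>q. a * f q) = a * v f"
    using lin[of f f a 0] by simp
  \<comment> \<open>From 1 = 1 * 1 the product rule gives v(1) = 2 v(1).\<close>
  have "v (\<lambda>q. 1) = 0"
    using mult[OF smooth_function_const smooth_function_const, of 1 1] by simp
  then show "v (\<lambda>q. a) = 0"
    using lin[OF smooth_function_const smooth_function_const, of a 1 0 1] by simp
qed

lemma tangent_sum:
  assumes "v \<in> tangent_space A p" "\<And>i. i \<in> I \<Longrightarrow> smooth_function A (f i)"
  shows "v (\<lambda>q. \<Sum>i\<in>I. f i q) = (\<Sum>i\<in>I. v (f i))"
  using assms(2)
proof (induction I rule: infinite_finite_induct)
  case (insert x F)
  then show ?case
    using tangent_add[OF assms(1), of "f x" "\<lambda>q. \<Sum>i\<in>F. f i q"] smooth_function_sum[of F f] by simp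
qed (simp_all add: tangent_const[OF assms(1)])

lemma tangent_space_comb:
  assumes "v \<in> tangent_space A p" "w \<in> tangent_space A p"
  shows "a *\<^sub>R v + b *\<^sub>R w \<in> tangent_space A p"
proof -
  note s = smooth_function_add smooth_function_mult smooth_function_const
  show ?thesis
    unfolding tangent_space_def
    by (auto simp: s tangent_add[OF assms(1)] tangent_add[OF assms(2)] tangent_cmult[OF assms(1)]
        tangent_cmult[OF assms(2)] tangent_mult[OF assms(1)] tangent_mult[OF assms(2)]
        tangent_not_smooth[OF assms(1)] tangent_not_smooth[OF assms(2)] algebra_simps)
qed

lemma tangent_space_0: "0 \<in> tangent_space A p"
  by (simp add: tangent_space_def)

lemma tangent_space_add:
  "v \<in> tangent_space A p \<Longrightarrow> w \<in> tangent_space A p \<Longrightarrow> v + w \<in> tangent_space A p"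
  using tangent_space_comb[of v p w 1 1] by simp

lemma tangent_space_scaleR: "v \<in> tangent_space A p \<Longrightarrow> a *\<^sub>R v \<in> tangent_space A p"
  using tangent_space_comb[OF _ tangent_space_0, of v p a 0] by simp

lemma tangent_space_diff:
  "v \<in> tangent_space A p \<Longrightarrow> w \<in> tangent_space A p \<Longrightarrow> v - w \<in> tangent_space A p"
  using tangent_space_comb[of v p w 1 "-1"] by simp

lemma vector_field_tangent: "vector_field A X \<Longrightarrow> X p \<in> tangent_space A p"
  by (simp add: vector_field_def)

lemma vector_field_smooth: "vector_field A X \<Longrightarrow> smooth_function A f \<Longrightarrow> smooth_function A (\<lambda>p. X p f)"
  by (simp add: vector_field_def)

lemma vector_field_0: "vector_field A 0"
  by (simp add: vector_field_def tangent_space_0 smooth_function_const)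

lemma vector_field_add: "vector_field A X \<Longrightarrow> vector_field A Y \<Longrightarrow> vector_field A (X + Y)"
  by (simp add: vector_field_def tangent_space_add smooth_function_add)

lemma vector_field_diff: "vector_field A X \<Longrightarrow> vector_field A Y \<Longrightarrow> vector_field A (X - Y)"
  by (simp add: vector_field_def tangent_space_diff smooth_function_diff)

lemma vector_field_smult:
  "smooth_function A u \<Longrightarrow> vector_field A X \<Longrightarrow> vector_field A (\<lambda>p. u p *\<^sub>R X p)"
  by (simp add: vector_field_def tangent_space_scaleR smooth_function_mult)

lemma vector_field_scaleR: "vector_field A X \<Longrightarrow> vector_field A (a *\<^sub>R X)"
  using vector_field_smult[OF smooth_function_const, of X a] by (simp add: scaleR_fun_def)

text \<open>
  Multiplying the coordinate fields of a chart by a bump function equal to \<open>1\<close> at \<open>p\<close> makes them global;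
  that they span the space of derivations at \<open>p\<close> is Hadamard's lemma, for which the value \<open>1\<close>
  at the single point \<open>p\<close> is enough.
\<close>

lemma global_coordinate_fields:
  obtains \<iota> :: "'e \<Rightarrow> 'm vfield" where
    "\<And>x. vector_field A (\<iota> x)"
    "\<And>a b x y q. \<iota> (a *\<^sub>R x + b *\<^sub>R y) q = a *\<^sub>R \<iota> x q + b *\<^sub>R \<iota> y q"
    "\<And>x. \<iota> x p = 0 \<Longrightarrow> x = 0"
    "\<And>v. v \<in> tangent_space A p \<Longrightarrow> \<exists>x. v = \<iota> x p"
proof -
  obtain U c where Uc: "(U, c) \<in> A" and pU: "p \<in> U"
    by (rule chart_exists)
  note cU = chart_image_open[OF Uc]
  obtain r where r: "r > 0" "ball (c p) (2 * r) \<subseteq> c ` U"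
  proof -
    obtain s where "s > 0" "ball (c p) s \<subseteq> c ` U"
      using cU pU open_contains_ball by (metis imageI)
    then show ?thesis using that[of "s / 2"] by simp
  qed
  have rK: "cball (c p) r \<subseteq> ball (c p) (2 * r)"
    using r(1) by auto
  obtain \<psi> :: "'e \<Rightarrow> real" where \<psi>: "smooth_on UNIV \<psi>" "\<psi> (c p) = 1" "\<And>x. x \<notin> cball (c p) r \<Longrightarrow> \<psi> x = 0"
    by (rule bump_function[OF r(1), of "c p"]) (rule that)
  have \<psi>s: "C_on k S \<psi>" for k S
    using \<psi>(1) by (auto simp: smooth_on_def intro: C_on_subset)
  let ?loc = "\<lambda>f x. f (inv_into U c x)"
  define \<iota> where "\<iota> x q f = (if q \<in> U \<and> smooth_function A f then
    \<psi> (c q) * frechet_derivative (?loc f) (at (c q)) x else 0)" for x :: 'e and q f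
  have C: "C_on k (c ` U) (?loc f)" if "smooth_function A f" for f k
    using that Uc by (auto simp: smooth_function_iff)
  have der: "(?loc f has_derivative frechet_derivative (?loc f) (at (c q))) (at (c q))"
    if "smooth_function A f" "q \<in> U" for f q
    using C_on_Suc_has_derivative[OF C[OF that(1)]] that(2) by blast
  have glue: "smooth_function A (\<lambda>q. if q \<in> U then \<psi> (c q) * F (c q) else 0)"
    if "smooth_on (c ` U) F" for F
    using that \<psi>(3) r(2) rK cU
    by (intro smooth_function_extension[OF Uc, where F = "\<lambda>x. \<psi> x * F x" and K = "cball (c p) r"])
      (auto simp: smooth_on_def intro: C_on_mult \<psi>s)
  have tang: "\<iota> x q \<in> tangent_space A q" for x q
  proof (cases "q \<in> U")
    case True
    show ?thesis
      unfolding tangent_space_def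
    proof (safe)
      fix f h :: "'m \<Rightarrow> real" and a b :: real
      assume fh: "smooth_function A f" "smooth_function A h"
      have "smooth_function A (\<lambda>q. a * f q + b * h q)" "smooth_function A (\<lambda>q. f q * h q)"
        by (intro smooth_function_add smooth_function_mult smooth_function_const fh)+
      moreover have "((\<lambda>x. a * ?loc f x + b * ?loc h x) has_derivative
          (\<lambda>x. a * frechet_derivative (?loc f) (at (c q)) x + b * frechet_derivative (?loc h) (at (c q)) x)) (at (c q))"
        by (intro derivative_intros der fh True)
      moreover have "((\<lambda>x. ?loc f x * ?loc h x) has_derivative
          (\<lambda>x. ?loc f (c q) * frechet_derivative (?loc h) (at (c q)) x + frechet_derivative (?loc f) (at (c q)) x * ?loc h (c q))) (at (c q))"
        by (intro derivative_intros der fh True)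
      ultimately show "\<iota> x q (\<lambda>q. a * f q + b * h q) = a * \<iota> x q f + b * \<iota> x q h"
        "\<iota> x q (\<lambda>q. f q * h q) = f q * \<iota> x q h + h q * \<iota> x q f"
        using fh True by (simp_all add: \<iota>_def frechet_derivative_at[symmetric] chart_inv[OF Uc] algebra_simps)
    qed (simp add: \<iota>_def)
  next
    case False
    then have "\<iota> x q = 0" by (simp add: \<iota>_def fun_eq_iff)
    then show ?thesis by (simp add: tangent_space_0)
  qed
  have D: "smooth_on (c ` U) (\<lambda>y. frechet_derivative (?loc f) (at y) x)" if "smooth_function A f" for f x
    using C[OF that] unfolding smooth_on_def by (metis C_on.simps(2))
  have vf: "vector_field A (\<iota> x)" for x
    unfolding vector_field_def
  proof (intro conjI allI impI tang)
    fix f :: "'m \<Rightarrow> real" assume f: "smooth_function A f"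
    then have "(\<lambda>q. \<iota> x q f) = (\<lambda>q. if q \<in> U then \<psi> (c q) * frechet_derivative (?loc f) (at (c q)) x else 0)"
      by (auto simp: \<iota>_def)
    then show "smooth_function A (\<lambda>q. \<iota> x q f)"
      using glue[OF D[OF f]] by simp
  qed
  have lin: "\<iota> (a *\<^sub>R x + b *\<^sub>R y) q = a *\<^sub>R \<iota> x q + b *\<^sub>R \<iota> y q" for a b x y q
  proof
    fix f
    show "\<iota> (a *\<^sub>R x + b *\<^sub>R y) q f = (a *\<^sub>R \<iota> x q + b *\<^sub>R \<iota> y q) f"
    proof (cases "q \<in> U \<and> smooth_function A f")
      case True
      then have "linear (frechet_derivative (?loc f) (at (c q)))"
        using der has_derivative_linear by blast
      then show ?thesis using True by (simp add: \<iota>_def linear_add linear_scale algebra_simps)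
    qed (auto simp: \<iota>_def)
  qed
  \<comment> \<open>Cut-off coordinates centred at \<open>p\<close>. Since they vanish at
    \<open>p\<close>, differentiating the factor \<psi> contributes nothing there, and they are dual
    to the fields \<open>\<iota> x\<close>.\<close>
  define z where "z b q = (if q \<in> U then \<psi> (c q) * ((c q - c p) \<bullet> b) else 0)" for b q
  have "smooth_on (c ` U) (\<lambda>x. (x - c p) \<bullet> b)" for b
    unfolding smooth_on_def diff_conv_add_uminus
    using cU by (intro allI C_on_bounded_linear[OF cU bounded_linear_inner_left] C_on_add C_on_ident C_on_const)
  then have zs: "smooth_function A (z b)" for b
    unfolding z_def by (rule glue)
  have zp: "z b p = 0" for b by (simp add: z_def)
  have zder: "\<iota> x p (z b) = x \<bullet> b" for x b
  proof -
    have "(\<psi> has_derivative frechet_derivative \<psi> (at (c p))) (at (c p))"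
      using C_on_Suc_has_derivative[OF \<psi>s[of 1 UNIV, simplified One_nat_def]] by simp
    then have "((\<lambda>x. \<psi> x * ((x - c p) \<bullet> b)) has_derivative (\<lambda>x. x \<bullet> b)) (at (c p))"
      using \<psi>(2) by (auto intro!: derivative_eq_intros)
    then have "(?loc (z b) has_derivative (\<lambda>x. x \<bullet> b)) (at (c p))"
      by (rule has_derivative_transform_within_open[OF _ cU])
        (use pU in \<open>auto simp: z_def chart_inv[OF Uc]\<close>)
    then show ?thesis
      using \<psi>(2) pU zs by (simp add: \<iota>_def frechet_derivative_at[symmetric])
  qed
  show ?thesis
  proof
    show "vector_field A (\<iota> x)" for x by (rule vf)
    show "\<iota> (a *\<^sub>R x + b *\<^sub>R y) q = a *\<^sub>R \<iota> x q + b *\<^sub>R \<iota> y q" for a b x y q by (rule lin)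
    show "x = 0" if "\<iota> x p = 0" for x
      using zder[of x] that by (auto intro!: euclidean_eqI[of x 0])
    fix v assume v: "v \<in> tangent_space A p"
    let ?x = "\<Sum>b\<in>Basis. v (z b) *\<^sub>R b"
    have "v f = \<iota> ?x p f" for f
    proof (cases "smooth_function A f")
      case True
      let ?B = "ball (c p) (2 * r)"
      have "smooth_on ?B (?loc f)"
        using C[OF True] r(2) unfolding smooth_on_def by (meson C_on_subset)
      then obtain G where G: "\<And>b. smooth_on ?B (G b)"
        "\<And>b. G b (c p) = frechet_derivative (?loc f) (at (c p)) b"
        "\<And>x. x \<in> ?B \<Longrightarrow> ?loc f x = ?loc f (c p) + (\<Sum>b\<in>Basis. ((x - c p) \<bullet> b) * G b x)"
        using hadamard[OF open_ball convex_ball, of "c p" "c p" "2 * r" "?loc f"] r(1) by auto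
      define W where "W b q = (if q \<in> U then \<psi> (c q) * G b (c q) else 0)" for b q
      define \<rho> where "\<rho> q = (if q \<in> U then \<psi> (c q) * 1 else 0)" for q
      have \<rho>s: "smooth_function A \<rho>"
        unfolding \<rho>_def by (rule glue) (simp add: smooth_on_def C_on_const)
      have Ws: "smooth_function A (W b)" for b
        unfolding W_def
      proof (rule smooth_function_extension[OF Uc, of "\<lambda>x. \<psi> x * G b x" "cball (c p) r"])
        \<comment> \<open>\<open>G b\<close> is controlled on the ball only, but the product
          vanishes identically off the smaller closed ball; these two open sets cover the chart
          image.\<close>
        have o: "open (c ` U - cball (c p) r)" using cU by auto
        have "C_on k (c ` U - cball (c p) r) (\<lambda>x. \<psi> x * G b x)" for k
          by (rule C_on_cong[OF o _ C_on_const[of _ _ 0]]) (simp add: \<psi>(3))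
        moreover have "C_on k ?B (\<lambda>x. \<psi> x * G b x)" for k
          using G(1) by (auto simp: smooth_on_def intro: C_on_mult \<psi>s)
        moreover have "(c ` U - cball (c p) r) \<union> ?B = c ` U"
          using r(2) rK by blast
        ultimately show "smooth_on (c ` U) (\<lambda>x. \<psi> x * G b x)"
          using C_on_Un[OF o open_ball] unfolding smooth_on_def by metis
      qed (use rK r(2) \<psi>(3) in auto)
      let ?h = "\<lambda>q. f q - f p" and ?k = "\<lambda>q. 1 - \<rho> q * \<rho> q"
      have hs: "smooth_function A ?h" and ks: "smooth_function A ?k"
        by (intro smooth_function_diff smooth_function_mult smooth_function_const True \<rho>s)+
      \<comment> \<open>Hadamard's expansion multiplied by \<psi> twice, once for the coordinate and
        once for the coefficient, gives the sum. In the remainder both \<open>?k\<close> and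
        \<open>?h\<close> vanish at \<open>p\<close>, so the product rule makes \<open>v\<close>
        kill it.\<close>
      have dec: "?h q = (\<Sum>b\<in>Basis. z b q * W b q) + ?k q * ?h q" for q
      proof (cases "q \<in> U \<and> c q \<in> cball (c p) r")
        case qU: True
        then have "?h q = (\<Sum>b\<in>Basis. ((c q - c p) \<bullet> b) * G b (c q))"
          using G(3)[of "c q"] rK pU by (auto simp: chart_inv[OF Uc])
        then have "\<rho> q * \<rho> q * ?h q = (\<Sum>b\<in>Basis. z b q * W b q)"
          using qU by (simp add: \<rho>_def z_def W_def sum_distrib_left algebra_simps)
        then show ?thesis by (simp add: algebra_simps)
      next
        case False
        then have "\<rho> q = 0" "W b q = 0" for b
          using \<psi>(3) by (auto simp: \<rho>_def W_def)
        then show ?thesis by simp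
      qed
      have zW: "v (\<lambda>q. z b q * W b q) = v (z b) * frechet_derivative (?loc f) (at (c p)) b" for b
        using tangent_mult[OF v zs Ws, of b b] zp pU \<psi>(2) G(2) by (simp add: W_def)
      have "v f = v ?h"
        using tangent_diff[OF v True smooth_function_const] tangent_const[OF v] by simp
      also have "\<dots> = v (\<lambda>q. (\<Sum>b\<in>Basis. z b q * W b q) + ?k q * ?h q)"
        by (rule arg_cong[of _ _ v], rule ext, rule dec)
      also have "\<dots> = (\<Sum>b\<in>Basis. v (\<lambda>q. z b q * W b q)) + v (\<lambda>q. ?k q * ?h q)"
        by (subst tangent_add[OF v]; (subst tangent_sum[OF v])?;
            intro smooth_function_sum smooth_function_mult zs Ws hs ks refl)
      also have "v (\<lambda>q. ?k q * ?h q) = 0"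
        using tangent_mult[OF v ks hs] pU \<psi>(2) by (simp add: \<rho>_def)
      also have "(\<Sum>b\<in>Basis. v (\<lambda>q. z b q * W b q)) + 0 = \<iota> ?x p f"
      proof -
        have "linear (frechet_derivative (?loc f) (at (c p)))"
          using der[OF True pU] has_derivative_linear by blast
        then show ?thesis
          using True pU \<psi>(2) by (simp add: zW \<iota>_def linear_sum linear_scale)
      qed
      finally show ?thesis .
    qed (simp add: tangent_not_smooth[OF v] tangent_not_smooth[OF tang])
    then show "\<exists>x. v = \<iota> x p" by blast
  qed
qed

end

section \<open>Orthonormal systems for a symmetric bilinear form\<close>

lemma independent_if_orthonormal:
  fixes e :: "nat \<Rightarrow> 'a::euclidean_space" and \<beta> :: "'a \<Rightarrow> 'a \<Rightarrow> real"
  assumes \<beta>: "\<And>x. linear (\<beta> x)"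
    and e: "\<And>i j. i < m \<Longrightarrow> j < m \<Longrightarrow> \<beta> (e i) (e j) = (if i = j then 1 else 0)"
  shows "independent (e ` {..<m})" "inj_on e {..<m}"
proof -
  show inj: "inj_on e {..<m}"
    by (rule inj_onI) (metis e lessThan_iff zero_neq_one)
  show "independent (e ` {..<m})"
  proof (rule independent_if_scalars_zero)
    fix f x assume s: "(\<Sum>x\<in>e ` {..<m}. f x *\<^sub>R x) = 0" and "x \<in> e ` {..<m}"
    then obtain i where i: "i < m" "x = e i" by auto
    have "0 = \<beta> x (\<Sum>j<m. f (e j) *\<^sub>R e j)"
      using s linear_0[OF \<beta>] by (simp add: sum.reindex[OF inj])
    also have "\<dots> = (\<Sum>j<m. f (e j) * (if i = j then 1 else 0))"
      unfolding i(2) linear_sum[OF \<beta>] using i(1) e by (intro sum.cong) (auto simp: linear_scale[OF \<beta>])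
    also have "\<dots> = f x" using i by (simp add: if_distrib sum.delta cong: if_cong)
    finally show "f x = 0" by simp
  qed simp
qed

text \<open>Gram-Schmidt, one vector at a time: while \<open>m\<close> is below the dimension some
  vector lies outside the span, and its normalised orthogonal part extends the system.\<close>

lemma orthonormal_system_exists:
  fixes \<beta> :: "'a::euclidean_space \<Rightarrow> 'a \<Rightarrow> real"
  assumes lin: "\<And>x. linear (\<beta> x)" and sym: "\<And>x y. \<beta> x y = \<beta> y x"
    and pos: "\<And>x. x \<noteq> 0 \<Longrightarrow> \<beta> x x > 0" and "m \<le> DIM('a)"
  shows "\<exists>e. \<forall>i<m. \<forall>j<m. \<beta> (e i) (e j) = (if i = j then 1 else 0)"
  using assms(4)
proof (induction m)
  case 0
  then show ?case by simp
next
  case (Suc m)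
  then obtain e where e: "\<And>i j. i < m \<Longrightarrow> j < m \<Longrightarrow> \<beta> (e i) (e j) = (if i = j then 1 else 0)"
    by auto
  have "dim (span (e ` {..<m})) \<le> m"
    using dim_le_card'[of "e ` {..<m}"] card_image_le[of "{..<m}" e] by (simp add: dim_span)
  then have "span (e ` {..<m}) \<noteq> UNIV"
    using Suc.prems by (metis dim_UNIV not_less_eq_eq)
  then obtain x where x: "x \<notin> span (e ` {..<m})" by blast
  define y where "y = x - (\<Sum>i<m. \<beta> x (e i) *\<^sub>R e i)"
  have y0: "y \<noteq> 0"
  proof
    assume "y = 0"
    then have "x = (\<Sum>i<m. \<beta> x (e i) *\<^sub>R e i)" by (simp add: y_def)
    moreover have "(\<Sum>i<m. \<beta> x (e i) *\<^sub>R e i) \<in> span (e ` {..<m})"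
      by (intro span_sum span_scale span_base) auto
    ultimately show False using x by simp
  qed
  have ye: "\<beta> (e j) y = 0" if "j < m" for j
  proof -
    have "\<beta> (e j) y = \<beta> (e j) x - (\<Sum>i<m. \<beta> x (e i) * (if j = i then 1 else 0))"
      unfolding y_def linear_diff[OF lin] linear_sum[OF lin]
      using that e by (intro arg_cong2[where f = minus] refl sum.cong) (auto simp: linear_scale[OF lin])
    also have "\<dots> = 0" using that sym by (simp add: if_distrib sum.delta cong: if_cong)
    finally show ?thesis .
  qed
  define z where "z = (1 / sqrt (\<beta> y y)) *\<^sub>R y"
  have zz: "\<beta> z z = 1"
    unfolding z_def linear_scale[OF lin] sym[of "_ *\<^sub>R y" y]
    using pos[OF y0] by (simp add: linear_scale[OF lin])
  have ze: "\<beta> (e j) z = 0" "\<beta> z (e j) = 0" if "j < m" for j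
    using ye[OF that] sym[of z "e j"] by (simp_all add: z_def linear_scale[OF lin])
  have "\<forall>i<Suc m. \<forall>j<Suc m. \<beta> ((e(m := z)) i) ((e(m := z)) j) = (if i = j then 1 else 0)"
    using e zz ze by (auto simp: less_Suc_eq)
  then show ?case by blast
qed

text \<open>A system of full size is independent, hence spans; pairing with \<open>e j\<close> reads
  off the coefficients of \<open>y\<close>.\<close>

lemma orthonormal_expansion:
  fixes e :: "nat \<Rightarrow> 'a::euclidean_space" and \<beta> :: "'a \<Rightarrow> 'a \<Rightarrow> real"
  assumes lin: "\<And>x. linear (\<beta> x)" and sym: "\<And>x y. \<beta> x y = \<beta> y x"
    and e: "\<And>i j. i < DIM('a) \<Longrightarrow> j < DIM('a) \<Longrightarrow> \<beta> (e i) (e j) = (if i = j then 1 else 0)"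
  shows "\<beta> x y = (\<Sum>i<DIM('a). \<beta> x (e i) * \<beta> y (e i))"
proof -
  let ?n = "DIM('a)"
  note ind = independent_if_orthonormal[OF lin e]
  have "card (e ` {..<?n}) = ?n" using ind(2) by (simp add: card_image)
  then have "UNIV \<subseteq> span (e ` {..<?n})"
    by (intro card_ge_dim_independent ind(1)) (auto simp: dim_UNIV)
  then have "y \<in> span (e ` {..<?n})" by blast
  then obtain u where "y = (\<Sum>x\<in>e ` {..<?n}. u x *\<^sub>R x)"
    by (auto simp: span_finite)
  then have y: "y = (\<Sum>i<?n. u (e i) *\<^sub>R e i)"
    by (simp add: sum.reindex[OF ind(2)])
  have "\<beta> y (e j) = u (e j)" if "j < ?n" for j
  proof -
    have "\<beta> (e j) y = (\<Sum>i<?n. u (e i) * (if j = i then 1 else 0))"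
      unfolding y linear_sum[OF lin]
      using that e by (intro sum.cong) (auto simp: linear_scale[OF lin])
    also have "\<dots> = u (e j)" using that by (simp add: if_distrib sum.delta cong: if_cong)
    finally show ?thesis using sym by simp
  qed
  then have "(\<Sum>i<?n. \<beta> x (e i) * \<beta> y (e i)) = (\<Sum>i<?n. \<beta> x (e i) * u (e i))"
    by (intro sum.cong) auto
  also have "\<dots> = \<beta> x (\<Sum>i<?n. u (e i) *\<^sub>R e i)"
    unfolding linear_sum[OF lin] by (simp add: linear_scale[OF lin] mult.commute)
  finally show ?thesis using y by simp
qed

locale riemannian_atlas = atlas A
  for A :: "('m::{second_countable_topology, t2_space}, 'e::euclidean_space) chart set" +
  fixes g :: "'m \<Rightarrow> 'm tangent \<Rightarrow> 'm tangent \<Rightarrow> real"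
  assumes riemannian_metric: "riemannian_metric A g"
begin

lemma
  assumes "v \<in> tangent_space A p" "w \<in> tangent_space A p"
  shows metric_sym: "g p v w = g p w v"
    and metric_pos: "v \<noteq> 0 \<Longrightarrow> g p v v > 0"
    and metric_comb: "u \<in> tangent_space A p \<Longrightarrow> g p v (a *\<^sub>R w + b *\<^sub>R u) = a * g p v w + b * g p v u"
  using assms riemannian_metric by (auto simp: riemannian_metric_def linear_on_subspace_def)

text \<open>Carries the metric at \<open>p\<close> back to the coordinate space \<open>'e\<close>,
  where the preceding linear algebra applies. Positivity comes from the independence of the
  coordinate fields at \<open>p\<close>.\<close>

lemma frame_coordinates:
  obtains \<iota> :: "'e \<Rightarrow> 'm vfield" and \<beta> :: "'e \<Rightarrow> 'e \<Rightarrow> real" where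
    "\<And>x. vector_field A (\<iota> x)"
    "\<And>v. v \<in> tangent_space A p \<Longrightarrow> \<exists>x. v = \<iota> x p"
    "\<And>x y. \<beta> x y = g p (\<iota> x p) (\<iota> y p)"
    "\<And>x. linear (\<beta> x)" "\<And>x y. \<beta> x y = \<beta> y x" "\<And>x. x \<noteq> 0 \<Longrightarrow> \<beta> x x > 0"
proof -
  obtain \<iota> :: "'e \<Rightarrow> 'm vfield" where \<iota>: "\<And>x. vector_field A (\<iota> x)"
    "\<And>a b x y q. \<iota> (a *\<^sub>R x + b *\<^sub>R y) q = a *\<^sub>R \<iota> x q + b *\<^sub>R \<iota> y q"
    "\<And>x. \<iota> x p = 0 \<Longrightarrow> x = 0"
    "\<And>v. v \<in> tangent_space A p \<Longrightarrow> \<exists>x. v = \<iota> x p"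
    by (rule global_coordinate_fields[of p]) (rule that)
  note T = vector_field_tangent[OF \<iota>(1)]
  show ?thesis
  proof (rule that[of \<iota> "\<lambda>x y. g p (\<iota> x p) (\<iota> y p)", OF \<iota>(1) \<iota>(4) refl])
    show "linear (\<lambda>y. g p (\<iota> x p) (\<iota> y p))" for x
    proof -
      have *: "g p (\<iota> x p) (\<iota> (a *\<^sub>R y + b *\<^sub>R z) p) = a * g p (\<iota> x p) (\<iota> y p) + b * g p (\<iota> x p) (\<iota> z p)"
        for a b y z
        unfolding \<iota>(2) by (rule metric_comb[OF T T T])
      show ?thesis
        using *[of 1 _ 1] *[of _ _ 0 0] by (intro linearI) simp_all
    qed
    show "g p (\<iota> x p) (\<iota> y p) = g p (\<iota> y p) (\<iota> x p)" for x y
      by (rule metric_sym[OF T T])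
    show "g p (\<iota> x p) (\<iota> x p) > 0" if "x \<noteq> 0" for x
      using metric_pos[OF T T] \<iota>(3) that by blast
  qed
qed

lemma orthonormal_frame_exists: "\<exists>E. orthonormal_frame_at A g p E"
proof -
  obtain \<iota> :: "'e \<Rightarrow> 'm vfield" and \<beta> where *:
    "\<And>x. vector_field A (\<iota> x)"
    "\<And>v. v \<in> tangent_space A p \<Longrightarrow> \<exists>x. v = \<iota> x p"
    "\<And>x y. \<beta> x y = g p (\<iota> x p) (\<iota> y p)"
    "\<And>x. linear (\<beta> x)" "\<And>x y. \<beta> x y = \<beta> y x" "\<And>x. x \<noteq> 0 \<Longrightarrow> \<beta> x x > 0"
    by (rule frame_coordinates[of p]) (rule that)
  obtain e where "\<forall>i<DIM('e). \<forall>j<DIM('e). \<beta> (e i) (e j) = (if i = j then 1 else 0)"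
    using orthonormal_system_exists[of \<beta>, OF *(4,5,6) order_refl] by blast
  then have "orthonormal_frame_at A g p (\<lambda>i. \<iota> (e i))"
    by (simp add: orthonormal_frame_at_def *(1) *(3)[symmetric])
  then show ?thesis by blast
qed

text \<open>Stated for an arbitrary frame, because the frame inside \<open>ricci\<close> is chosen
  and known only to be orthonormal.\<close>

lemma parseval:
  assumes "orthonormal_frame_at A g p E" "v \<in> tangent_space A p" "w \<in> tangent_space A p"
  shows "g p v w = (\<Sum>i<DIM('e). g p v (E i p) * g p w (E i p))"
proof -
  obtain \<iota> :: "'e \<Rightarrow> 'm vfield" and \<beta> where *:
    "\<And>x. vector_field A (\<iota> x)"
    "\<And>v. v \<in> tangent_space A p \<Longrightarrow> \<exists>x. v = \<iota> x p"
    "\<And>x y. \<beta> x y = g p (\<iota> x p) (\<iota> y p)"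
    "\<And>x. linear (\<beta> x)" "\<And>x y. \<beta> x y = \<beta> y x" "\<And>x. x \<noteq> 0 \<Longrightarrow> \<beta> x x > 0"
    by (rule frame_coordinates[of p]) (rule that)
  have "\<forall>i. \<exists>x. i < DIM('e) \<longrightarrow> E i p = \<iota> x p"
    using assms(1) *(2) vector_field_tangent by (metis orthonormal_frame_at_def)
  then obtain e where e: "\<And>i. i < DIM('e) \<Longrightarrow> E i p = \<iota> (e i) p"
    by metis
  obtain x y where xy: "v = \<iota> x p" "w = \<iota> y p"
    using *(2)[OF assms(2)] *(2)[OF assms(3)] by blast
  have on: "\<beta> (e i) (e j) = (if i = j then 1 else 0)" if "i < DIM('e)" "j < DIM('e)" for i j
    using assms(1) that e by (simp add: orthonormal_frame_at_def *(3))
  have "\<beta> x y = (\<Sum>i<DIM('e). \<beta> x (e i) * \<beta> y (e i))"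
    by (rule orthonormal_expansion[OF *(4,5) on])
  then show ?thesis
    unfolding xy *(3) using e by simp
qed

end

section \<open>The Levi-Civita connection\<close>

text \<open>A named form of the anonymous function in \<open>affine_connection\<close>, so that
  rewrite rules can match the product of a function and a field.\<close>

definition smul :: "('m \<Rightarrow> real) \<Rightarrow> 'm vfield \<Rightarrow> 'm vfield" where
  "smul u X = (\<lambda>p. u p *\<^sub>R X p)"

lemma smul_apply: "smul u X p = u p *\<^sub>R X p"
  by (simp add: smul_def)

lemma smul_const: "smul (\<lambda>p. a) X = a *\<^sub>R X"
  by (simp add: smul_def fun_eq_iff)

lemma smul_0 [simp]: "smul u 0 = 0"
  by (simp add: smul_def fun_eq_iff)

locale levi_civita = riemannian_atlas A g
  for A :: "('m::{second_countable_topology, t2_space}, 'e::euclidean_space) chart set"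
    and g :: "'m \<Rightarrow> 'm tangent \<Rightarrow> 'm tangent \<Rightarrow> real" +
  fixes nabla :: "'m vfield \<Rightarrow> 'm vfield \<Rightarrow> 'm vfield"
  assumes levi_civita: "levi_civita_connection A g nabla"
begin

abbreviation VF :: "'m vfield \<Rightarrow> bool" where
  "VF \<equiv> vector_field A"

abbreviation sm :: "('m \<Rightarrow> real) \<Rightarrow> bool" where
  "sm \<equiv> smooth_function A"

abbreviation R :: "'m vfield \<Rightarrow> 'm vfield \<Rightarrow> 'm vfield \<Rightarrow> 'm vfield" where
  "R \<equiv> curvature nabla"

text \<open>With the point as last argument, \<open>ip Y Z\<close> is itself a function on the
  manifold, to which a field can be applied.\<close>

definition ip :: "'m vfield \<Rightarrow> 'm vfield \<Rightarrow> 'm \<Rightarrow> real" where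
  "ip X Y p = g p (X p) (Y p)"

declare vector_field_0 [simp] vector_field_add [simp] vector_field_diff [simp]
  vector_field_scaleR [simp] smooth_function_const [simp] smooth_function_add [simp]
  smooth_function_diff [simp] smooth_function_minus [simp] smooth_function_mult [simp]

lemma vector_field_uminus [simp]: "VF X \<Longrightarrow> VF (- X)"
  using vector_field_scaleR[of X "-1"] by simp

lemma vector_field_smul [simp]: "sm u \<Longrightarrow> VF X \<Longrightarrow> VF (smul u X)"
  unfolding smul_def by (rule vector_field_smult)

lemma smooth_ip [simp]: "VF X \<Longrightarrow> VF Y \<Longrightarrow> sm (ip X Y)"
  using riemannian_metric by (simp add: riemannian_metric_def ip_def[abs_def])

lemma smooth_derivative [simp]: "VF X \<Longrightarrow> sm f \<Longrightarrow> sm (\<lambda>p. X p f)"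
  by (rule vector_field_smooth)

lemma ip_sym: "VF X \<Longrightarrow> VF Y \<Longrightarrow> ip X Y p = ip Y X p"
  unfolding ip_def by (rule metric_sym) (auto intro: vector_field_tangent)

lemma ip_comb_right:
  assumes "VF X" "VF Y" "VF Z"
  shows "g p (X p) (a *\<^sub>R Y p + b *\<^sub>R Z p) = a * ip X Y p + b * ip X Z p"
  unfolding ip_def by (rule metric_comb) (auto intro: vector_field_tangent assms)

lemma ip_add_right [simp]: "VF X \<Longrightarrow> VF Y \<Longrightarrow> VF Z \<Longrightarrow> ip X (Y + Z) p = ip X Y p + ip X Z p"
  using ip_comb_right[of X Y Z p 1 1] by (simp add: ip_def)

lemma ip_diff_right [simp]: "VF X \<Longrightarrow> VF Y \<Longrightarrow> VF Z \<Longrightarrow> ip X (Y - Z) p = ip X Y p - ip X Z p"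
  using ip_comb_right[of X Y Z p 1 "-1"] by (simp add: ip_def)

lemma ip_smul_right [simp]: "VF X \<Longrightarrow> VF Y \<Longrightarrow> ip X (smul u Y) p = u p * ip X Y p"
  using ip_comb_right[of X Y Y p "u p" 0] by (simp add: ip_def smul_def)

lemma ip_scaleR_right [simp]: "VF X \<Longrightarrow> VF Y \<Longrightarrow> ip X (a *\<^sub>R Y) p = a * ip X Y p"
  using ip_comb_right[of X Y Y p a 0] by (simp add: ip_def)

lemma ip_minus_right [simp]: "VF X \<Longrightarrow> VF Y \<Longrightarrow> ip X (- Y) p = - ip X Y p"
  using ip_scaleR_right[of X Y "-1" p] by simp

lemma ip_0_right [simp]: "VF X \<Longrightarrow> ip X 0 p = 0"
  using ip_scaleR_right[of X 0 0 p] by simp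

lemma ip_left [simp]:
  assumes "VF X" "VF Y"
  shows "VF Z \<Longrightarrow> ip (Y + Z) X p = ip Y X p + ip Z X p"
    and "VF Z \<Longrightarrow> ip (Y - Z) X p = ip Y X p - ip Z X p"
    and "sm u \<Longrightarrow> ip (smul u Y) X p = u p * ip Y X p"
    and "ip (a *\<^sub>R Y) X p = a * ip Y X p"
    and "ip (- Y) X p = - ip Y X p"
    and "ip 0 X p = 0"
  using assms by (simp_all add: ip_sym[where Y = X])

lemma ip_pos: "VF X \<Longrightarrow> X p \<noteq> 0 \<Longrightarrow> ip X X p > 0"
  unfolding ip_def by (rule metric_pos) (auto intro: vector_field_tangent)

text \<open>Nondegeneracy, by testing with the field \<open>X - Y\<close> itself; the argument stays
  within global fields.\<close>

lemma vf_eqI: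
  assumes X: "VF X" and Y: "VF Y" and eq: "\<And>W p. VF W \<Longrightarrow> ip X W p = ip Y W p"
  shows "X = Y"
proof
  fix p
  have "ip (X - Y) (X - Y) p = 0" using X Y eq[of "X - Y" p] by simp
  then have "(X - Y) p = 0" using ip_pos[of "X - Y" p] X Y by fastforce
  then show "X p = Y p" by simp
qed

lemma nabla_vf [simp]: "VF X \<Longrightarrow> VF Y \<Longrightarrow> VF (nabla X Y)"
  using levi_civita by (simp add: levi_civita_connection_def affine_connection_def)

lemma nabla_simps [simp]:
  assumes "VF X" "VF Y"
  shows nabla_add_left: "VF Z \<Longrightarrow> nabla (X + Y) Z = nabla X Z + nabla Y Z"
    and nabla_add: "VF Z \<Longrightarrow> nabla X (Y + Z) = nabla X Y + nabla X Z"
    and nabla_smul_left: "sm u \<Longrightarrow> nabla (smul u X) Y = smul u (nabla X Y)"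
    and nabla_smul: "sm u \<Longrightarrow> nabla X (smul u Y) = smul (\<lambda>p. X p u) Y + smul u (nabla X Y)"
  using levi_civita assms
  by (simp_all add: levi_civita_connection_def affine_connection_def smul_def plus_fun_def)

lemma nabla_scaleR [simp]: "VF X \<Longrightarrow> VF Y \<Longrightarrow> nabla X (a *\<^sub>R Y) = a *\<^sub>R nabla X Y"
  using nabla_smul[of X Y "\<lambda>p. a"] tangent_const[OF vector_field_tangent, of X _ a]
  by (simp add: smul_const)

lemma nabla_scaleR_left [simp]: "VF X \<Longrightarrow> VF Y \<Longrightarrow> nabla (a *\<^sub>R X) Y = a *\<^sub>R nabla X Y"
  using nabla_smul_left[of X Y "\<lambda>p. a"] by (simp add: smul_const)

lemma nabla_minus [simp]: "VF X \<Longrightarrow> VF Y \<Longrightarrow> nabla X (- Y) = - nabla X Y"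
  using nabla_scaleR[of X Y "-1"] by simp

lemma nabla_minus_left [simp]: "VF X \<Longrightarrow> VF Y \<Longrightarrow> nabla (- X) Y = - nabla X Y"
  using nabla_scaleR_left[of X Y "-1"] by simp

lemma nabla_diff [simp]: "VF X \<Longrightarrow> VF Y \<Longrightarrow> VF Z \<Longrightarrow> nabla X (Y - Z) = nabla X Y - nabla X Z"
  using nabla_add[of X Y "- Z"] by simp

lemma nabla_diff_left [simp]: "VF X \<Longrightarrow> VF Y \<Longrightarrow> VF Z \<Longrightarrow> nabla (X - Y) Z = nabla X Z - nabla Y Z"
  using nabla_add_left[of X "- Y" Z] by simp

lemma nabla_0 [simp]: "VF X \<Longrightarrow> nabla X 0 = 0"
  using nabla_scaleR[of X 0 0] by simp

lemma lie_bracket_eq: "VF X \<Longrightarrow> VF Y \<Longrightarrow> lie_bracket X Y = nabla X Y - nabla Y X"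
  using levi_civita by (simp add: levi_civita_connection_def)

lemma lie_bracket_vf [simp]: "VF X \<Longrightarrow> VF Y \<Longrightarrow> VF (lie_bracket X Y)"
  by (simp add: lie_bracket_eq)

lemma derivative_ip:
  "VF X \<Longrightarrow> VF Y \<Longrightarrow> VF Z \<Longrightarrow> X p (ip Y Z) = ip (nabla X Y) Z p + ip Y (nabla X Z) p"
  using levi_civita by (simp add: levi_civita_connection_def ip_def[abs_def])

section \<open>Symmetries of the curvature tensor\<close>

lemma R_vf [simp]: "VF X \<Longrightarrow> VF Y \<Longrightarrow> VF Z \<Longrightarrow> VF (R X Y Z)"
  by (simp add: curvature_def)

lemma R_swap: "VF X \<Longrightarrow> VF Y \<Longrightarrow> VF Z \<Longrightarrow> R Y X Z = - R X Y Z"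
  by (simp add: curvature_def lie_bracket_eq)

lemma R_add [simp]: "VF X \<Longrightarrow> VF Y \<Longrightarrow> VF Z \<Longrightarrow> VF W \<Longrightarrow> R X Y (Z + W) = R X Y Z + R X Y W"
  by (simp add: curvature_def)

lemma R_scaleR [simp]: "VF X \<Longrightarrow> VF Y \<Longrightarrow> VF Z \<Longrightarrow> R X Y (a *\<^sub>R Z) = a *\<^sub>R R X Y Z"
  by (simp add: curvature_def scaleR_diff_right)

lemma R_smul [simp]:
  assumes "VF X" "VF Y" "VF Z" "sm u"
  shows "R X Y (smul u Z) = smul u (R X Y Z)"
proof
  fix p
  \<comment> \<open>This cancels the second derivatives of \<open>u\<close>; the terms with first
    derivatives cancel in pairs.\<close>
  have lb: "X p (\<lambda>q. Y q u) = lie_bracket X Y p u + Y p (\<lambda>q. X q u)"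
    by (simp add: lie_bracket_def)
  show "R X Y (smul u Z) p = smul u (R X Y Z) p"
    using assms by (simp add: curvature_def smul_apply lb algebra_simps)
qed

text \<open>X Y - Y X - [X, Y] annihilates the function g(Z, W); when it is expanded by metric
  compatibility, the products of first derivatives cancel.\<close>

lemma R_metric:
  assumes "VF X" "VF Y" "VF Z" "VF W"
  shows "ip (R X Y Z) W p = - ip Z (R X Y W) p"
proof -
  have D: "(\<lambda>q. X q (ip Z W)) = (\<lambda>q. ip (nabla X Z) W q + ip Z (nabla X W) q)" if "VF X" for X
    using assms that by (simp add: derivative_ip)
  have "X p (\<lambda>q. Y q (ip Z W)) = X p (ip (nabla Y Z) W) + X p (ip Z (nabla Y W))"
    "Y p (\<lambda>q. X q (ip Z W)) = Y p (ip (nabla X Z) W) + Y p (ip Z (nabla X W))"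
    using assms by (simp_all add: D tangent_add[OF vector_field_tangent])
  moreover have "lie_bracket X Y p (ip Z W) = X p (\<lambda>q. Y q (ip Z W)) - Y p (\<lambda>q. X q (ip Z W))"
    by (simp add: lie_bracket_def)
  ultimately show ?thesis
    using assms by (simp add: derivative_ip curvature_def)
qed

lemma jacobi:
  assumes "VF X" "VF Y" "VF Z"
  shows "lie_bracket X (lie_bracket Y Z) + lie_bracket Y (lie_bracket Z X) + lie_bracket Z (lie_bracket X Y) = 0"
proof (intro ext)
  fix p f
  have D: "X p (\<lambda>q. lie_bracket Y Z q f) = X p (\<lambda>q. Y q (\<lambda>q. Z q f)) - X p (\<lambda>q. Z q (\<lambda>q. Y q f))"
    if "VF X" "VF Y" "VF Z" for X Y Z
  proof (cases "sm f")
    case True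
    then show ?thesis
      using that tangent_diff[OF vector_field_tangent[OF that(1)], of "\<lambda>q. Y q (\<lambda>q. Z q f)" "\<lambda>q. Z q (\<lambda>q. Y q f)"]
      by (simp add: lie_bracket_def)
  next
    \<comment> \<open>Equality of fields also tests functions that are not smooth; on those every
      tangent vector is 0 by convention.\<close>
    case False
    then have "Y q f = 0" "Z q f = 0" for q
      using that tangent_not_smooth[OF vector_field_tangent] by blast+
    then show ?thesis
      using that by (simp add: lie_bracket_def tangent_const[OF vector_field_tangent])
  qed
  show "(lie_bracket X (lie_bracket Y Z) + lie_bracket Y (lie_bracket Z X) + lie_bracket Z (lie_bracket X Y)) p f
      = (0 :: 'm vfield) p f"
    using assms by (simp add: lie_bracket_def[of _ "lie_bracket _ _"] D) (simp add: lie_bracket_def)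
qed

text \<open>Vanishing torsion turns the cyclic sum into the Jacobi identity.\<close>

lemma bianchi:
  assumes "VF X" "VF Y" "VF Z"
  shows "R X Y Z + R Y Z X + R Z X Y = 0"
  using jacobi[OF assms] assms by (simp add: curvature_def lie_bracket_eq algebra_simps)

text \<open>Combine the Bianchi identities for the four cyclic rotations of the arguments; the two
  skew symmetries cancel everything else.\<close>

lemma R_pair_symmetry:
  assumes "VF X" "VF Y" "VF Z" "VF W"
  shows "ip (R X Y Z) W p = ip (R Z W X) Y p"
proof -
  have b: "ip (R X Y Z) W p + ip (R Y Z X) W p + ip (R Z X Y) W p = 0"
    if "VF X" "VF Y" "VF Z" "VF W" for X Y Z W
  proof -
    have "ip (R X Y Z + R Y Z X + R Z X Y) W p = 0" using that by (simp add: bianchi)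
    then show ?thesis using that by simp
  qed
  have s: "ip (R X Y Z) W p = - ip (R Y X Z) W p" "ip (R X Y Z) W p = - ip (R X Y W) Z p"
    if "VF X" "VF Y" "VF Z" "VF W" for X Y Z W
    using that R_swap[of Y X Z] R_metric[of X Y Z W p] ip_sym[of "R X Y W" Z p] by auto
  show ?thesis
    using b[OF assms(1,2,3,4)] b[OF assms(2,3,4,1)] b[OF assms(3,4,1,2)] b[OF assms(4,1,2,3)]
      s(1)[OF assms(1,2,4,3)] s(2)[OF assms(1,2,3,4)] s(1)[OF assms(2,3,4,1)] s(2)[OF assms(2,3,1,4)]
      s(1)[OF assms(3,4,1,2)] s(2)[OF assms(3,4,1,2)] s(1)[OF assms(4,1,2,3)] s(2)[OF assms(4,1,2,3)]
      s(1)[OF assms(3,1,2,4)] s(2)[OF assms(3,1,2,4)] s(1)[OF assms(2,4,3,1)] s(2)[OF assms(2,4,3,1)]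
      s(2)[OF assms(1,3,4,2)] s(2)[OF assms(4,2,1,3)]
    by linarith
qed

end

section \<open>Contact metric manifolds and solitons\<close>

locale contact_metric = levi_civita A g nabla
  for A :: "('m::{second_countable_topology, t2_space}, 'e::euclidean_space) chart set"
    and g :: "'m \<Rightarrow> 'm tangent \<Rightarrow> 'm tangent \<Rightarrow> real"
    and nabla :: "'m vfield \<Rightarrow> 'm vfield \<Rightarrow> 'm vfield" +
  fixes n :: nat
    and \<phi> :: "'m \<Rightarrow> 'm tangent \<Rightarrow> 'm tangent"
    and \<xi> :: "'m vfield"
    and \<eta> :: "'m \<Rightarrow> 'm tangent \<Rightarrow> real"
  assumes contact_metric: "contact_metric_manifold A n \<phi> \<xi> \<eta> g"
begin

definition \<Phi> :: "'m vfield \<Rightarrow> 'm vfield" where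
  "\<Phi> X = (\<lambda>p. \<phi> p (X p))"

definition T :: "'m vfield \<Rightarrow> 'm vfield" where
  "T X = nabla X \<xi>"

lemma DIM_eq: "DIM('e) = 2 * n + 1"
  and n_pos: "n \<ge> 1"
  and xi_vf [simp]: "VF \<xi>"
  using contact_metric by (simp_all add: contact_metric_manifold_def)

lemma Phi_vf [simp]: "VF X \<Longrightarrow> VF (\<Phi> X)"
  using contact_metric by (simp add: contact_metric_manifold_def tensor_field_1_1_def \<Phi>_def)

lemma Phi_comb:
  assumes "VF X" "VF Y"
  shows "\<phi> p (a *\<^sub>R X p + b *\<^sub>R Y p) = a *\<^sub>R \<phi> p (X p) + b *\<^sub>R \<phi> p (Y p)"
  using contact_metric vector_field_tangent[OF assms(1), of p] vector_field_tangent[OF assms(2), of p]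
  by (simp add: contact_metric_manifold_def tensor_field_1_1_def linear_on_subspace_def)

lemma Phi_simps [simp]:
  assumes "VF X"
  shows Phi_add: "VF Y \<Longrightarrow> \<Phi> (X + Y) = \<Phi> X + \<Phi> Y"
    and Phi_diff: "VF Y \<Longrightarrow> \<Phi> (X - Y) = \<Phi> X - \<Phi> Y"
    and Phi_smul: "\<Phi> (smul u X) = smul u (\<Phi> X)"
    and Phi_scaleR: "\<Phi> (a *\<^sub>R X) = a *\<^sub>R \<Phi> X"
    and Phi_minus: "\<Phi> (- X) = - \<Phi> X"
proof -
  show "\<Phi> (X + Y) = \<Phi> X + \<Phi> Y" if "VF Y"
    using Phi_comb[OF assms that, of _ 1 1] by (simp add: \<Phi>_def fun_eq_iff)
  show "\<Phi> (X - Y) = \<Phi> X - \<Phi> Y" if "VF Y"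
    using Phi_comb[OF assms that, of _ 1 "-1"] by (simp add: \<Phi>_def fun_eq_iff)
  show "\<Phi> (smul u X) = smul u (\<Phi> X)"
    using Phi_comb[OF assms assms, of _ "u _" 0] by (simp add: \<Phi>_def smul_def fun_eq_iff)
  show "\<Phi> (a *\<^sub>R X) = a *\<^sub>R \<Phi> X"
    using Phi_comb[OF assms assms, of _ a 0] by (simp add: \<Phi>_def fun_eq_iff)
  show "\<Phi> (- X) = - \<Phi> X"
    using Phi_comb[OF assms assms, of _ "-1" 0] by (simp add: \<Phi>_def fun_eq_iff)
qed

lemma Phi_xi [simp]: "\<Phi> \<xi> = 0"
  using contact_metric by (simp add: contact_metric_manifold_def \<Phi>_def fun_eq_iff)

lemma metric_eta:
  assumes "VF X" "VF Y"
  shows "ip X Y p = ip (\<Phi> X) (\<Phi> Y) p + \<eta> p (X p) * \<eta> p (Y p)"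
  using contact_metric assms by (simp add: contact_metric_manifold_def ip_def \<Phi>_def)

text \<open>Metric compatibility with Y = xi, where phi xi = 0 and eta(xi) = 1.\<close>

lemma eta_eq: "VF X \<Longrightarrow> \<eta> p (X p) = ip X \<xi> p"
  using metric_eta[of X \<xi> p] contact_metric by (simp add: contact_metric_manifold_def)

lemma ip_xi_xi [simp]: "ip \<xi> \<xi> p = 1"
  using eta_eq[of \<xi> p] contact_metric by (simp add: contact_metric_manifold_def)

lemma ip_Phi_Phi: "VF X \<Longrightarrow> VF Y \<Longrightarrow> ip X Y p = ip (\<Phi> X) (\<Phi> Y) p + ip X \<xi> p * ip Y \<xi> p"
  using metric_eta[of X Y p] by (simp add: eta_eq)

lemma Phi_Phi [simp]:
  assumes "VF X"
  shows "\<Phi> (\<Phi> X) = smul (ip X \<xi>) \<xi> - X"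
proof
  fix p
  have "\<phi> p (\<phi> p (X p)) = - X p + \<eta> p (X p) *\<^sub>R \<xi> p"
    using contact_metric vector_field_tangent[OF assms, of p] by (simp add: contact_metric_manifold_def)
  then show "\<Phi> (\<Phi> X) p = (smul (ip X \<xi>) \<xi> - X) p"
    using assms by (simp add: \<Phi>_def smul_apply eta_eq)
qed

lemma ip_Phi_xi [simp]:
  assumes "VF X"
  shows "ip (\<Phi> X) \<xi> p = 0" "ip \<xi> (\<Phi> X) p = 0"
proof -
  have "\<eta> p (\<Phi> X p) = 0"
    using contact_metric vector_field_tangent[OF assms, of p] by (simp add: contact_metric_manifold_def \<Phi>_def)
  then show "ip (\<Phi> X) \<xi> p = 0" using assms by (simp add: eta_eq)
  then show "ip \<xi> (\<Phi> X) p = 0" using assms ip_sym by simp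
qed

lemma Phi_skew:
  assumes "VF X" "VF Y"
  shows "ip (\<Phi> X) Y p = - ip X (\<Phi> Y) p"
  using ip_Phi_Phi[of "\<Phi> X" Y p] assms by simp

lemma T_vf [simp]: "VF X \<Longrightarrow> VF (T X)"
  by (simp add: T_def)

lemma T_simps [simp]:
  assumes "VF X"
  shows T_add: "VF Y \<Longrightarrow> T (X + Y) = T X + T Y"
    and T_diff: "VF Y \<Longrightarrow> T (X - Y) = T X - T Y"
    and T_smul: "sm u \<Longrightarrow> T (smul u X) = smul u (T X)"
    and T_scaleR: "T (a *\<^sub>R X) = a *\<^sub>R T X"
    and T_minus: "T (- X) = - T X"
  using assms by (simp_all add: T_def)

lemma ip_T_xi [simp]:
  assumes "VF X"
  shows "ip (T X) \<xi> p = 0" "ip \<xi> (T X) p = 0"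
proof -
  have "ip \<xi> \<xi> = (\<lambda>p. 1)" by (simp add: fun_eq_iff)
  then have "X p (ip \<xi> \<xi>) = 0"
    using assms by (simp add: tangent_const[OF vector_field_tangent])
  then show "ip (T X) \<xi> p = 0"
    using assms ip_sym[of "nabla X \<xi>" \<xi> p] by (simp add: derivative_ip T_def)
  then show "ip \<xi> (T X) p = 0" using assms ip_sym by simp
qed

text \<open>d eta is the antisymmetric part of nabla eta, so the adjoint of \<open>T\<close> is T +
  2 phi. As a rewrite rule this moves \<open>T\<close> across an inner product.\<close>

lemma T_adjoint:
  assumes "VF X" "VF Y"
  shows "ip (T X) Y p = ip X (T Y) p + 2 * ip X (\<Phi> Y) p"
proof -
  have "(\<lambda>q. \<eta> q (Y q)) = ip Y \<xi>" "(\<lambda>q. \<eta> q (X q)) = ip X \<xi>" "\<eta> p (lie_bracket X Y p) = ip (lie_bracket X Y) \<xi> p"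
    using assms by (simp_all add: eta_eq fun_eq_iff)
  moreover have "ip X (\<Phi> Y) p = d_one_form \<eta> X Y p"
    using contact_metric assms by (simp add: contact_metric_manifold_def ip_def \<Phi>_def)
  ultimately have "2 * ip X (\<Phi> Y) p = X p (ip Y \<xi>) - Y p (ip X \<xi>) - ip (lie_bracket X Y) \<xi> p"
    by (simp add: d_one_form_def)
  also have "\<dots> = ip Y (T X) p - ip X (T Y) p"
    using assms by (simp add: derivative_ip lie_bracket_eq T_def)
  finally show ?thesis using assms ip_sym[of Y "T X" p] by simp
qed

text \<open>The adjoint T + 2 phi takes values orthogonal to xi.\<close>

lemma T_xi [simp]: "T \<xi> = 0"
  by (rule vf_eqI) (simp_all add: T_adjoint)

text \<open>Opens the choice inside \<open>ricci\<close> once; the sums below rely on normalisation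
  and Parseval.\<close>

lemma ricci_frame:
  obtains E where "\<And>i. i < DIM('e) \<Longrightarrow> VF (E i)"
    "\<And>i. i < DIM('e) \<Longrightarrow> ip (E i) (E i) p = 1"
    "\<And>X Y. VF X \<Longrightarrow> VF Y \<Longrightarrow> (\<Sum>i<DIM('e). ip X (E i) p * ip Y (E i) p) = ip X Y p"
    "\<And>Y Z. ricci A g nabla Y Z p = (\<Sum>i<DIM('e). ip (R (E i) Y Z) (E i) p)"
proof -
  define E where "E = (SOME E. orthonormal_frame_at A g p E)"
  have E: "orthonormal_frame_at A g p E"
    unfolding E_def using orthonormal_frame_exists by (rule someI_ex)
  show ?thesis
  proof (rule that[of E])
    show "VF (E i)" "ip (E i) (E i) p = 1" if "i < DIM('e)" for i
      using E that by (simp_all add: orthonormal_frame_at_def ip_def)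
    show "(\<Sum>i<DIM('e). ip X (E i) p * ip Y (E i) p) = ip X Y p" if "VF X" "VF Y" for X Y
      unfolding ip_def by (rule parseval[symmetric]) (use E that vector_field_tangent in auto)
    show "ricci A g nabla Y Z p = (\<Sum>i<DIM('e). ip (R (E i) Y Z) (E i) p)" for Y Z
      by (simp add: ricci_def E_def[symmetric] ip_def)
  qed
qed

end

locale nullity_contact_metric = contact_metric A g nabla n \<phi> \<xi> \<eta>
  for A :: "('m::{second_countable_topology, t2_space}, 'e::euclidean_space) chart set"
    and g nabla n \<phi> \<xi> \<eta> +
  fixes k :: real
  assumes R_xi: "VF X \<Longrightarrow> VF Y \<Longrightarrow> R X Y \<xi> = k *\<^sub>R (smul (ip Y \<xi>) X - smul (ip X \<xi>) Y)"
begin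

text \<open>The factor 2n is the dimension 2n + 1, less 1 for the terms along xi, which Parseval
  sums.\<close>

lemma ricci_xi:
  assumes "VF X"
  shows "ricci A g nabla X \<xi> p = 2 * real n * k * ip X \<xi> p"
proof -
  obtain E where E: "\<And>i. i < DIM('e) \<Longrightarrow> VF (E i)"
    "\<And>i. i < DIM('e) \<Longrightarrow> ip (E i) (E i) p = 1"
    "\<And>X Y. VF X \<Longrightarrow> VF Y \<Longrightarrow> (\<Sum>i<DIM('e). ip X (E i) p * ip Y (E i) p) = ip X Y p"
    "\<And>Y Z. ricci A g nabla Y Z p = (\<Sum>i<DIM('e). ip (R (E i) Y Z) (E i) p)"
    by (rule ricci_frame[of p]) (rule that)
  have "ip (R (E i) X \<xi>) (E i) p = k * (ip X \<xi> p - ip \<xi> (E i) p * ip X (E i) p)" if "i < DIM('e)" for i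
    using E(1,2)[OF that] assms ip_sym[of "E i" \<xi> p] by (simp add: R_xi)
  then have "ricci A g nabla X \<xi> p = (\<Sum>i<DIM('e). k * (ip X \<xi> p - ip \<xi> (E i) p * ip X (E i) p))"
    unfolding E(4) by (intro sum.cong) auto
  also have "\<dots> = k * (real (DIM('e)) * ip X \<xi> p - ip \<xi> X p)"
    using E(3)[of \<xi> X] assms by (simp add: sum_distrib_left[symmetric] sum_subtractf)
  finally show ?thesis
    using assms ip_sym[of \<xi> X p] by (simp add: DIM_eq algebra_simps)
qed

end

section \<open>Gradient solitons with nonzero k\<close>

locale gradient_soliton = nullity_contact_metric A g nabla n \<phi> \<xi> \<eta> k
  for A :: "('m::{second_countable_topology, t2_space}, 'e::euclidean_space) chart set"
    and g nabla n \<phi> \<xi> \<eta> k +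
  fixes f :: "'m \<Rightarrow> real" and lam :: real and D :: "'m vfield"
  assumes soliton: "gradient_ricci_soliton A g nabla f lam"
    and gradient: "is_gradient A g f D"
begin

lemma D_vf [simp]: "VF D" and ip_D: "VF X \<Longrightarrow> ip D X p = X p f"
  using gradient by (simp_all add: is_gradient_def ip_def)

lemma hessian_eq:
  assumes "VF X" "VF Y"
  shows "hessian nabla f X Y p = ip (nabla X D) Y p"
proof -
  have "(\<lambda>q. Y q f) = ip D Y" using assms by (simp add: ip_D fun_eq_iff)
  then show ?thesis using assms ip_D[of "nabla X Y" p] by (simp add: hessian_def derivative_ip)
qed

lemma nabla_D:
  assumes "VF X" "VF Y"
  shows "ip (nabla X D) Y p = ricci A g nabla X Y p + lam * ip X Y p"
  using soliton assms hessian_eq[OF assms, of p] by (simp add: gradient_ricci_soliton_def ip_def)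

text \<open>X Y f - Y X f = [X, Y] f, and the connection has no torsion.\<close>

lemma nabla_D_sym:
  assumes "VF X" "VF Y"
  shows "ip (nabla X D) Y p = ip (nabla Y D) X p"
proof -
  have e: "(\<lambda>q. Y q f) = ip D Y" "(\<lambda>q. X q f) = ip D X" using assms by (simp_all add: ip_D fun_eq_iff)
  have "X p (\<lambda>q. Y q f) - Y p (\<lambda>q. X q f) = lie_bracket X Y p f"
    by (simp add: lie_bracket_def)
  also have "\<dots> = ip D (nabla X Y) p - ip D (nabla Y X) p"
    using assms by (simp add: lie_bracket_eq ip_D)
  finally show ?thesis using assms unfolding e by (simp add: derivative_ip)
qed

lemma gradient_eq_0:
  assumes k: "k \<noteq> 0"
  shows "D = 0"
proof -
  let ?c = "2 * real n * k + lam"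
  have N: "ip (nabla X D) \<xi> p = ?c * ip X \<xi> p" if "VF X" for X p
    using that by (simp add: nabla_D ricci_xi algebra_simps)
  \<comment> \<open>\<open>N\<close> gives the xi-component of every nabla_X D; symmetry of the
    Hessian turns this into nabla_xi D itself.\<close>
  have Nxi: "nabla \<xi> D = ?c *\<^sub>R \<xi>"
    by (rule vf_eqI) (use nabla_D_sym N ip_sym in auto)
  \<comment> \<open>The xi-components of the three terms of R(xi, Y) D cancel, so by
    \<open>R_metric\<close> the gradient is orthogonal to R(xi, Y) xi = k (eta(Y) xi - Y); then
    divide by \<open>k\<close>.\<close>
  have D: "D = smul (ip D \<xi>) \<xi>"
  proof (rule vf_eqI)
    fix Y p assume Y: "VF Y"
    have e: "ip (nabla Y D) \<xi> = (\<lambda>p. ?c * ip Y \<xi> p)"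
      using N[OF Y] by (simp add: fun_eq_iff)
    have "\<xi> p (ip (nabla Y D) \<xi>) = ?c * (\<xi> p (ip Y \<xi>))"
      unfolding e using Y by (simp add: tangent_cmult[OF vector_field_tangent])
    then have 1: "ip (nabla \<xi> (nabla Y D)) \<xi> p = ?c * ip (nabla \<xi> Y) \<xi> p"
      using Y T_xi by (simp add: derivative_ip T_def)
    have 2: "ip (nabla Y (nabla \<xi> D)) \<xi> p = 0"
      unfolding Nxi using Y ip_T_xi[of Y p] by (simp add: T_def)
    have 3: "ip (nabla (lie_bracket \<xi> Y) D) \<xi> p = ?c * ip (nabla \<xi> Y) \<xi> p"
      using Y N ip_T_xi[of Y p] by (simp add: lie_bracket_eq T_def algebra_simps)
    have "ip (R \<xi> Y D) \<xi> p = 0"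
      using Y 1 2 3 by (simp add: curvature_def)
    then have "ip D (R \<xi> Y \<xi>) p = 0"
      using R_metric[of \<xi> Y D \<xi> p] Y by simp
    then have "k * (ip Y \<xi> p * ip D \<xi> p - ip D Y p) = 0"
      using Y by (simp add: R_xi)
    then show "ip D Y p = ip (smul (ip D \<xi>) \<xi>) Y p"
      using k Y ip_sym[of Y \<xi> p] by (simp add: mult.commute)
  qed simp_all
  define u where "u = ip D \<xi>"
  have u[simp]: "sm u" and Du: "D = smul u \<xi>" using D by (simp_all add: u_def)
  have "u p = 0" for p
  proof -
    obtain E where E: "\<And>i. i < DIM('e) \<Longrightarrow> VF (E i)"
      "\<And>i. i < DIM('e) \<Longrightarrow> ip (E i) (E i) p = 1"
      "\<And>X Y. VF X \<Longrightarrow> VF Y \<Longrightarrow> (\<Sum>i<DIM('e). ip X (E i) p * ip Y (E i) p) = ip X Y p"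
      by (rule ricci_frame[of p]) (rule that)
    have z: "u p * (1 - ip \<xi> (E i) p * ip \<xi> (E i) p) = 0" if "i < DIM('e)" for i
    proof -
      \<comment> \<open>Both fields are orthogonal to xi, so the derivatives of \<open>u\<close>
        drop out of nabla (u xi). As \<open>?X\<close> is phi applied to \<open>?Y\<close>, the
        antisymmetric part of \<open>T\<close> yields the squared norm of \<open>?X\<close>.\<close>
      let ?X = "\<Phi> (\<Phi> (E i))" and ?Y = "\<Phi> (E i)"
      have v: "VF (E i)" "VF ?X" "VF ?Y" using E(1)[OF that] by (simp_all del: Phi_Phi)
      have "ip (nabla ?X D) ?Y p - ip (nabla ?Y D) ?X p = u p * (ip (T ?X) ?Y p - ip (T ?Y) ?X p)"
        unfolding Du using v by (simp add: T_def[symmetric] algebra_simps del: Phi_Phi)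
      also have "ip (T ?X) ?Y p - ip (T ?Y) ?X p = 2 * ip ?X ?X p"
        using T_adjoint[OF v(2,3), of p] ip_sym[OF v(2) T_vf[OF v(3)], of p] by (simp del: Phi_Phi)
      also have "ip ?X ?X p = 1 - ip \<xi> (E i) p * ip \<xi> (E i) p"
        using ip_Phi_Phi[OF v(3,3), of p] ip_Phi_Phi[OF v(1,1), of p] E(2)[OF that] v ip_sym[of "E i" \<xi> p]
        by (simp del: Phi_Phi)
      finally show ?thesis using nabla_D_sym[OF v(2,3), of p] by simp
    qed
    \<comment> \<open>Summing over the frame turns the factor into (2n + 1) - 1 = 2n > 0, so no
      particular vector independent of xi has to be singled out.\<close>
    then have "0 = (\<Sum>i<DIM('e). u p * (1 - ip \<xi> (E i) p * ip \<xi> (E i) p))"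
      by (intro sum.neutral[symmetric]) blast
    also have "\<dots> = u p * (2 * real n)"
      using E(3)[of \<xi> \<xi>] by (simp add: sum_distrib_left[symmetric] sum_subtractf DIM_eq)
    finally show ?thesis using n_pos by simp
  qed
  then show ?thesis
    unfolding Du by (simp add: smul_def fun_eq_iff)
qed

end

section \<open>The case \<open>k = 0\<close>\<close>

locale zero_nullity = contact_metric A g nabla n \<phi> \<xi> \<eta>
  for A :: "('m::{second_countable_topology, t2_space}, 'e::euclidean_space) chart set"
    and g nabla n \<phi> \<xi> \<eta> +
  assumes R_xi: "VF X \<Longrightarrow> VF Y \<Longrightarrow> R X Y \<xi> = 0"
begin

text \<open>The covariant derivative (nabla_Z T) X of the tensor \<open>T\<close>.\<close>

definition B :: "'m vfield \<Rightarrow> 'm vfield \<Rightarrow> 'm vfield" where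
  "B Z X = nabla Z (T X) - T (nabla Z X)"

definition P :: "'m vfield \<Rightarrow> 'm vfield" where
  "P X = (1 / 2) *\<^sub>R \<Phi> (T X)"

lemma B_vf [simp]: "VF Z \<Longrightarrow> VF X \<Longrightarrow> VF (B Z X)"
  by (simp add: B_def)

lemma P_vf [simp]: "VF X \<Longrightarrow> VF (P X)"
  by (simp add: P_def)

text \<open>The Codazzi equation: without torsion the difference of the two sides is R(Z, X)
  xi.\<close>

lemma B_sym:
  assumes "VF Z" "VF X"
  shows "B Z X = B X Z"
  using R_xi[OF assms] assms
  by (simp add: curvature_def lie_bracket_eq B_def T_def algebra_simps)

lemma smul_ip_xi_0 [simp]:
  "VF X \<Longrightarrow> smul (ip (T X) \<xi>) Y = 0" "VF X \<Longrightarrow> smul (ip (\<Phi> X) \<xi>) Y = 0"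
  by (simp_all add: smul_def fun_eq_iff)

lemma nabla_xi_xi [simp]: "nabla \<xi> \<xi> = 0"
  using T_xi by (simp add: T_def)

lemma B_xi_right: "VF Z \<Longrightarrow> B Z \<xi> = - T (T Z)"
  by (simp add: B_def T_def[of Z])

text \<open>A Riccati equation, nabla_xi T = - T^2: by Codazzi (nabla_xi T) X = (nabla_X T) xi, and
  T xi = 0.\<close>

lemma nabla_xi_T: "VF X \<Longrightarrow> nabla \<xi> (T X) = T (nabla \<xi> X) - T (T X)"
  using B_sym[of \<xi> X] B_xi_right[of X] by (simp add: B_def algebra_simps)

text \<open>Differentiate along xi the fact that the adjoint of \<open>T\<close> is T + 2 phi, and
  replace the derivatives of \<open>T\<close> by the Riccati equation.\<close>

lemma nabla_xi_Phi_diff: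
  assumes Y: "VF Y"
  shows "nabla \<xi> (\<Phi> Y) - \<Phi> (nabla \<xi> Y) = - (\<Phi> (T Y) + T (\<Phi> Y) + 2 *\<^sub>R \<Phi> (\<Phi> Y))"
proof (rule vf_eqI)
  fix X p assume X: "VF X"
  have "ip (T X) Y = (\<lambda>q. ip X (T Y) q + 2 * ip X (\<Phi> Y) q)"
    using X Y by (simp add: T_adjoint fun_eq_iff)
  then have "\<xi> p (ip (T X) Y) = \<xi> p (\<lambda>q. ip X (T Y) q + 2 * ip X (\<Phi> Y) q)" by simp
  also have "\<dots> = \<xi> p (ip X (T Y)) + 2 * \<xi> p (ip X (\<Phi> Y))"
    using X Y tangent_add[OF vector_field_tangent[OF xi_vf], of "ip X (T Y)" "\<lambda>q. 2 * ip X (\<Phi> Y) q" p]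
      tangent_cmult[OF vector_field_tangent[OF xi_vf], of "ip X (\<Phi> Y)" p 2] by simp
  finally have "ip (T (nabla \<xi> X)) Y p - ip (T (T X)) Y p + ip (T X) (nabla \<xi> Y) p =
      ip (nabla \<xi> X) (T Y) p + (ip X (T (nabla \<xi> Y)) p - ip X (T (T Y)) p)
      + 2 * (ip (nabla \<xi> X) (\<Phi> Y) p + ip X (nabla \<xi> (\<Phi> Y)) p)"
    using X Y by (simp add: derivative_ip nabla_xi_T)
  moreover have "ip (T (T X)) Y p = ip X (T (T Y)) p + 2 * ip X (\<Phi> (T Y)) p
      + 2 * (ip X (T (\<Phi> Y)) p + 2 * ip X (\<Phi> (\<Phi> Y)) p)"
    using X Y by (simp add: T_adjoint del: Phi_Phi)
  ultimately have "ip X (nabla \<xi> (\<Phi> Y) - \<Phi> (nabla \<xi> Y)) p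
      = ip X (- (\<Phi> (T Y) + T (\<Phi> Y) + 2 *\<^sub>R \<Phi> (\<Phi> Y))) p"
    using X Y T_adjoint[of "nabla \<xi> X" Y p] T_adjoint[of X "nabla \<xi> Y" p] by (simp del: Phi_Phi)
  then show "ip (nabla \<xi> (\<Phi> Y) - \<Phi> (nabla \<xi> Y)) X p
      = ip (- (\<Phi> (T Y) + T (\<Phi> Y) + 2 *\<^sub>R \<Phi> (\<Phi> Y))) X p"
    using X Y by (simp only: ip_sym[of _ X] nabla_vf Phi_vf xi_vf T_vf vector_field_diff
        vector_field_uminus vector_field_add vector_field_scaleR)
qed (use Y in simp_all)

text \<open>Differentiating \<open>\<phi>\<^sup>2 = - I + \<eta> \<otimes> \<xi>\<close> along \<open>\<xi>\<close>.\<close>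

lemma Phi_T_Phi:
  assumes X: "VF X"
  shows "\<Phi> (T (\<Phi> X)) = T X + 2 *\<^sub>R \<Phi> X"
proof (rule vf_eqI)
  fix W p assume W: "VF W"
  let ?N = "\<lambda>X. nabla \<xi> (\<Phi> X) - \<Phi> (nabla \<xi> X)"
  have "(\<lambda>p. \<xi> p (ip X \<xi>)) = ip (nabla \<xi> X) \<xi>"
    using X by (simp add: derivative_ip fun_eq_iff)
  then have "?N (\<Phi> X) + \<Phi> (?N X) = 0"
    using X by simp
  then have "ip (?N (\<Phi> X) + \<Phi> (?N X)) W p = 0"
    using W by simp
  then have "ip (?N (\<Phi> X)) W p + ip (\<Phi> (?N X)) W p = 0"
    using X W by (subst (asm) ip_left(1)) simp_all
  then show "ip (\<Phi> (T (\<Phi> X))) W p = ip (T X + 2 *\<^sub>R \<Phi> X) W p"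
    unfolding nabla_xi_Phi_diff[OF X] nabla_xi_Phi_diff[OF Phi_vf[OF X]] using X W by simp
qed (use X in simp_all)

text \<open>\<open>Phi_T_Phi\<close> at phi X. The anticommutator of \<open>T\<close> and phi is
  twice the projection off xi, which makes phi parallel along xi.\<close>

lemma T_Phi: "VF X \<Longrightarrow> T (\<Phi> X) = 2 *\<^sub>R (X - smul (ip X \<xi>) \<xi>) - \<Phi> (T X)"
  using Phi_T_Phi[of "\<Phi> X"] by (simp add: algebra_simps)

lemma nabla_xi_Phi: "VF X \<Longrightarrow> nabla \<xi> (\<Phi> X) = \<Phi> (nabla \<xi> X)"
  using nabla_xi_Phi_diff[of X] by (simp add: T_Phi algebra_simps)

text \<open>Differentiating the anticommutator along xi gives T^2 phi + phi T^2 = 0, while the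
  anticommutator itself makes T^2 commute with phi. Hence phi T^2 = 0, and T^2 takes values
  orthogonal to xi.\<close>

lemma T_T [simp]:
  assumes X: "VF X"
  shows "T (T X) = 0"
proof -
  have d: "(\<lambda>p. \<xi> p (ip X \<xi>)) = ip (nabla \<xi> X) \<xi>"
    using X by (simp add: derivative_ip fun_eq_iff)
  have "nabla \<xi> (T (\<Phi> X)) = T (nabla \<xi> (\<Phi> X)) - T (T (\<Phi> X))"
    using X by (simp add: nabla_xi_T)
  then have "\<Phi> (T (T X)) = - T (T (\<Phi> X))"
    using X by (simp add: nabla_xi_Phi T_Phi nabla_xi_T d algebra_simps)
  moreover have "T (T (\<Phi> X)) = \<Phi> (T (T X))"
    using X by (simp add: T_Phi[of X] T_Phi[of "T X"] algebra_simps)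
  ultimately have "2 *\<^sub>R \<Phi> (T (T X)) = 0" by (simp add: scaleR_2)
  then have "\<Phi> (\<Phi> (T (T X))) = \<Phi> 0" by simp
  then show ?thesis using X Phi_scaleR[of 0 0] by simp
qed

lemma T_Phi_T: "VF X \<Longrightarrow> T (\<Phi> (T X)) = 2 *\<^sub>R T X"
  using Phi_scaleR[of 0 0] by (simp add: T_Phi[of "T X"])

lemma P_diff: "VF X \<Longrightarrow> VF Y \<Longrightarrow> P (X - Y) = P X - P Y"
  by (simp add: P_def scaleR_diff_right)

lemma T_P [simp]: "VF X \<Longrightarrow> T (P X) = T X"
  by (simp add: P_def T_Phi_T)

lemma P_T [simp]: "VF X \<Longrightarrow> P (T X) = 0"
  using Phi_scaleR[of 0 0] by (simp add: P_def)

lemma P_P [simp]: "VF X \<Longrightarrow> P (P X) = P X"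
  by (simp add: P_def[of "P X"]) (simp add: P_def)

lemma Phi_P: "VF X \<Longrightarrow> 2 *\<^sub>R \<Phi> (P X) = - T X"
  by (simp add: P_def)

lemma Phi_T: "VF X \<Longrightarrow> \<Phi> (T X) = 2 *\<^sub>R P X"
  by (simp add: P_def)

text \<open>The splitting into the eigenspaces of h for 1, -1 and 0. The middle part is written as a
  value of \<open>T\<close>, so that T^2 = 0 applies to it.\<close>

lemma decomposition: "VF X \<Longrightarrow> X = P X + (1 / 2) *\<^sub>R T (\<Phi> X) + smul (ip X \<xi>) \<xi>"
  by (simp add: T_Phi P_def algebra_simps)

lemma ip_T_T:
  assumes "VF X" "VF Y"
  shows "ip (T X) (T Y) p = 4 * ip X (P Y) p"
  using assms by (simp add: T_adjoint[of X "T Y"] Phi_T)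

text \<open>The left side of \<open>ip_T_T\<close> is symmetric in the two fields.\<close>

lemma P_adjoint:
  assumes "VF X" "VF Y"
  shows "ip (P X) Y p = ip X (P Y) p"
  using ip_T_T[OF assms, of p] ip_T_T[OF assms(2,1), of p] ip_sym[of "T X" "T Y" p] ip_sym[of Y "P X" p] assms
  by simp

section \<open>The covariant derivative of \<open>T\<close>\<close>

lemma B_simps [simp]:
  assumes "VF Z" "VF X"
  shows "VF Y \<Longrightarrow> B Z (X + Y) = B Z X + B Z Y"
    and "B Z (a *\<^sub>R X) = a *\<^sub>R B Z X"
    and "sm u \<Longrightarrow> B Z (smul u X) = smul u (B Z X)"
    and "B Z \<xi> = 0"
proof -
  show "sm u \<Longrightarrow> B Z (smul u X) = smul u (B Z X)"
    using assms by (intro ext) (simp add: B_def smul_apply algebra_simps)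
qed (use assms in \<open>simp_all add: B_xi_right, simp_all add: B_def algebra_simps\<close>)

text \<open>T^2 = 0 differentiates to (nabla_Z T) T = - T (nabla_Z T); then \<open>T\<close> moves
  to \<open>W\<close> as its adjoint T + 2 phi. This adjoint kills the image of \<open>P\<close> and
  sends T W to 4 P W, whence the next two lemmas.\<close>

lemma ip_B_T:
  assumes "VF Z" "VF X" "VF W"
  shows "ip (B Z (T X)) W p = - ip (B Z X) (T W + 2 *\<^sub>R \<Phi> W) p"
proof -
  have "ip (T (nabla Z X)) (T W + 2 *\<^sub>R \<Phi> W) p = 0"
    using assms T_adjoint[of "nabla Z X" "T W + 2 *\<^sub>R \<Phi> W" p] by (simp add: T_Phi algebra_simps)
  then show ?thesis
    using assms by (simp add: B_def T_adjoint[of _ W])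
qed

lemma ip_B_T_P: "VF Z \<Longrightarrow> VF X \<Longrightarrow> VF W \<Longrightarrow> ip (B Z (T X)) (P W) p = 0"
  using Phi_P[of W] by (simp add: ip_B_T)

lemma ip_B_T_T: "VF Z \<Longrightarrow> VF X \<Longrightarrow> VF W \<Longrightarrow> ip (B Z (T X)) (T W) p = - 4 * ip (B Z X) (P W) p"
  by (simp add: ip_B_T Phi_T)

lemma ip_B_xi: "VF Z \<Longrightarrow> VF X \<Longrightarrow> ip (B Z X) \<xi> p = - ip (T X) (T Z) p"
proof -
  assume v: "VF Z" "VF X"
  have "ip (T X) \<xi> = (\<lambda>p. 0)" using v by (simp add: fun_eq_iff)
  then have "Z p (ip (T X) \<xi>) = 0" using v by (simp add: tangent_const[OF vector_field_tangent])
  then have "ip (nabla Z (T X)) \<xi> p + ip (T X) (T Z) p = 0"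
    using v by (simp add: derivative_ip T_def[of Z])
  then show ?thesis using v by (simp add: B_def)
qed

text \<open>\<open>T\<close> doubles lengths on the image of \<open>P\<close>: differentiate g(T P
  X, T P W) = 4 g(P X, P W) along Z.\<close>

lemma B_skew:
  assumes v: "VF Z" "VF X" "VF W"
  shows "ip (B Z (P X)) (T W) p = - ip (B Z (P W)) (T X) p"
proof -
  have "ip (T (P X)) (T (P W)) = (\<lambda>p. 4 * ip (P X) (P W) p)"
    using v ip_T_T[of "P X" "P W"] by (simp add: fun_eq_iff)
  then have "Z p (ip (T (P X)) (T (P W))) = 4 * Z p (ip (P X) (P W))"
    using v by (simp only: tangent_cmult[OF vector_field_tangent] smooth_ip P_vf)
  moreover have "ip (T (nabla Z (P X))) (T (P W)) p = 4 * ip (nabla Z (P X)) (P W) p"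
    "ip (T (nabla Z (P W))) (T (P X)) p = 4 * ip (nabla Z (P W)) (P X) p"
    using v ip_T_T[of "nabla Z (P X)" "P W" p] ip_T_T[of "nabla Z (P W)" "P X" p] by simp_all
  ultimately show ?thesis
    using v ip_sym[of "T X" "nabla Z (T W)" p] ip_sym[of "P X" "nabla Z (P W)" p]
    by (simp add: derivative_ip B_def)
qed

text \<open>Symmetric in Z and X by Codazzi, skew in X and W by \<open>B_skew\<close>; alternating
  the two returns to the start with the opposite sign.\<close>

lemma B_P_P_T:
  assumes v: "VF Z" "VF X" "VF W"
  shows "ip (B (P Z) (P X)) (T W) p = 0"
  using B_skew[of "P Z" X W p] B_skew[of "P W" Z X p] B_skew[of "P X" W Z p]
    B_sym[of "P Z" "P W"] B_sym[of "P W" "P X"] B_sym[of "P X" "P Z"] v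
  by simp

lemma B_P_P_P:
  assumes v: "VF Z" "VF X" "VF W"
  shows "ip (B (P Z) (P X)) (P W) p = 0"
proof -
  \<comment> \<open>Codazzi and \<open>ip_B_T_T\<close> trade the T-argument for a component with
    all arguments in the image of \<open>P\<close>. This transfers the skewness of
    \<open>B_skew\<close>, and the same alternation applies.\<close>
  have r: "ip (B (T Z) (P X)) (T W) p = - 4 * ip (B (P X) (P Z)) (P W) p" if "VF Z" "VF X" "VF W" for Z X W
    using that ip_B_T_T[of "P X" "P Z" W p] B_sym[of "T Z" "P X"] by simp
  show ?thesis
    using B_skew[of "T Z" X W p] B_skew[of "T W" Z X p] B_skew[of "T X" W Z p]
      r[OF v] r[of W Z X] r[of X W Z] r[of Z W X] r[of W X Z] r[of X Z W]
      B_sym[of "P Z" "P W"] B_sym[of "P W" "P X"] B_sym[of "P X" "P Z"] v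
    by simp
qed

text \<open>By \<open>decomposition\<close> and Codazzi the first two arguments reduce to their
  P-parts: xi contributes 0 and values of \<open>T\<close> are covered by
  \<open>ip_B_T_P\<close>.\<close>

lemma ip_B_P:
  assumes v: "VF Z" "VF X" "VF W"
  shows "ip (B Z X) (P W) p = 0"
proof -
  have 1: "ip (B Z X) (P W) p = ip (B Z (P X)) (P W) p" if "VF Z" "VF X" for Z X
    using that v by (subst decomposition[of X]) (simp_all add: ip_B_T_P)
  show ?thesis
    using 1[of Z X] 1[of "P X" Z] B_P_P_P[of X Z W p] B_sym[of Z "P X"] v by simp
qed

lemma ip_B_T_right:
  assumes v: "VF Z" "VF X" "VF W"
  shows "ip (B Z X) (T W) p = 0"
proof -
  have 1: "ip (B Z X) (T W) p = ip (B Z (P X)) (T W) p" if "VF Z" "VF X" for Z X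
    using that v by (subst decomposition[of X]) (simp_all add: ip_B_T_T ip_B_P)
  show ?thesis
    using 1[of Z X] 1[of "P X" Z] B_P_P_T[of X Z W p] B_sym[of Z "P X"] v by simp
qed

lemma ip_B:
  assumes v: "VF Z" "VF X" "VF W"
  shows "ip (B Z X) W p = - ip (T X) (T Z) p * ip W \<xi> p"
  using v by (subst decomposition[of W]) (simp_all add: ip_B_P ip_B_T_right ip_B_xi)

lemma nabla_T:
  assumes v: "VF Z" "VF X"
  shows "nabla Z (T X) = T (nabla Z X) - smul (ip (T X) (T Z)) \<xi>"
proof (rule vf_eqI)
  fix W p assume W: "VF W"
  show "ip (nabla Z (T X)) W p = ip (T (nabla Z X) - smul (ip (T X) (T Z)) \<xi>) W p"
    using ip_B[OF v W, of p] v W ip_sym[of \<xi> W p] by (simp add: B_def)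
qed (use v in simp_all)

text \<open>Differentiate g(T X, T W) = 4 g(P X, W) along Z. The error term in
  \<open>nabla_T\<close> lies along xi, hence is orthogonal to the image of
  \<open>T\<close>.\<close>

lemma nabla_P:
  assumes v: "VF Z" "VF X"
  shows "nabla Z (P X) = P (nabla Z X)"
proof (rule vf_eqI)
  fix W p assume W: "VF W"
  have "ip (T X) (T W) = (\<lambda>p. 4 * ip (P X) W p)"
    using v W by (simp add: ip_T_T P_adjoint fun_eq_iff)
  then have "Z p (ip (T X) (T W)) = 4 * Z p (ip (P X) W)"
    using v W by (simp only: tangent_cmult[OF vector_field_tangent] smooth_ip P_vf)
  then show "ip (nabla Z (P X)) W p = ip (P (nabla Z X)) W p"
    using v W ip_T_T[of "nabla Z X" W p] ip_T_T[of X "nabla Z W" p]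
    by (simp add: derivative_ip nabla_T P_adjoint)
qed (use v in simp_all)

section \<open>Curvature and Ricci tensor for k = 0\<close>

lemma R_T:
  assumes v: "VF X" "VF Y" "VF Z"
  shows "R X Y (T Z) = T (R X Y Z) + smul (ip (T X) (T Z)) (T Y) - smul (ip (T Y) (T Z)) (T X)"
proof (rule vf_eqI)
  fix W p assume W: "VF W"
  show "ip (R X Y (T Z)) W p =
      ip (T (R X Y Z) + smul (ip (T X) (T Z)) (T Y) - smul (ip (T Y) (T Z)) (T X)) W p"
    \<comment> \<open>The two corrections arise when the multiple of xi in \<open>nabla_T\<close> is
      differentiated once more, since nabla_X xi = T X.\<close>
    using v W ip_sym[of "T X" "T Z" p] ip_sym[of "T Y" "T Z" p]
    by (simp add: curvature_def lie_bracket_eq nabla_T derivative_ip T_def[symmetric] algebra_simps)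
qed (use v in simp_all)

lemma R_P: "VF X \<Longrightarrow> VF Y \<Longrightarrow> VF Z \<Longrightarrow> R X Y (P Z) = P (R X Y Z)"
  by (simp add: curvature_def nabla_P) (simp add: P_def algebra_simps)

lemma ip_R_T_P [simp]: "VF X \<Longrightarrow> VF Y \<Longrightarrow> VF Z \<Longrightarrow> VF W \<Longrightarrow> ip (R X Y (T Z)) (P W) p = 0"
  using R_P[of X Y "T Z"] P_adjoint[of "R X Y (T Z)" W p] R_smul[of X Y \<xi> "\<lambda>p. 0"]
  by (simp add: smul_const)

lemma R_T_T:
  assumes v: "VF X" "VF Y" "VF Z"
  shows "R (T X) (T Y) Z = 0"
proof -
  have 1: "R (T X) (T Y) (P Z) = 0" if Z: "VF Z" for Z
  proof (rule vf_eqI)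
    fix W p assume W: "VF W"
    note v = v(1,2) Z
    \<comment> \<open>In the Bianchi identity the other two terms apply a curvature operator to a
      value of \<open>T\<close> and have no P-component; the first term consists of its P-component
      only.\<close>
    have "ip (R (T X) (T Y) (P Z) + R (T Y) (P Z) (T X) + R (P Z) (T X) (T Y)) (P W) p = 0"
      using v W by (simp add: bianchi)
    then have "ip (R (T X) (T Y) (P Z)) (P W) p = 0" using v W by simp
    moreover have "R (T X) (T Y) (P Z) = P (R (T X) (T Y) (P Z))"
      using R_P[of "T X" "T Y" "P Z"] v by simp
    ultimately show "ip (R (T X) (T Y) (P Z)) W p = ip 0 W p"
      using v W P_adjoint[of "R (T X) (T Y) (P Z)" W p] by simp
  qed (use v Z in simp_all)
  \<comment> \<open>The corrections in \<open>R_T\<close> carry a factor T^2 = 0, so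
    \<open>T\<close> commutes with R(T X, T Y); inserting T = T P reduces the claim to fact
    \<open>1\<close>.\<close>
  have 2: "R (T X) (T Y) (T (\<Phi> Z)) = 0"
  proof -
    let ?W = "\<Phi> Z"
    have "R (T X) (T Y) (T ?W) = T (R (T X) (T Y) ?W)"
      using R_T[of "T X" "T Y" ?W] v by simp
    also have "\<dots> = T (P (R (T X) (T Y) ?W))" using v by simp
    also have "P (R (T X) (T Y) ?W) = R (T X) (T Y) (P ?W)" using R_P v by simp
    also have "R (T X) (T Y) (P ?W) = 0" using v by (simp add: 1)
    also have "T 0 = 0" using T_scaleR[OF xi_vf, of 0] by simp
    finally show ?thesis .
  qed
  show ?thesis
    using v 1 2 by (subst decomposition[of Z]) (simp_all add: R_xi)
qed

text \<open>By components: pair symmetry reduces the T-component to \<open>R_T_T\<close>,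
  parallelism of \<open>P\<close> removes the P-component, and nullity with \<open>R_metric\<close>
  the xi-component.\<close>

lemma R_T_0:
  assumes v: "VF X" "VF Y" "VF Z"
  shows "R X Y (T Z) = 0"
proof (rule vf_eqI)
  fix W p assume W: "VF W"
  have "ip (R X Y (T Z)) (T (\<Phi> W)) p = 0"
    using R_pair_symmetry[of X Y "T Z" "T (\<Phi> W)" p] R_T_T[of Z "\<Phi> W" X] v W by simp
  moreover have "ip (R X Y (T Z)) \<xi> p = 0"
    using R_metric[of X Y "T Z" \<xi> p] R_xi[of X Y] v by simp
  ultimately show "ip (R X Y (T Z)) W p = ip 0 W p"
    using v W by (subst decomposition[of W]) simp_all
qed (use v in simp_all)

text \<open>Since R(X, Y) T Z = 0, \<open>R_T\<close> determines T R(X, Y) Z, and applying phi / 2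
  gives P R(X, Y) Z. This is all of R(X, Y) Z, because R(X, Y) vanishes on the other two parts of
  Z.\<close>

lemma curvature_eq:
  assumes v: "VF X" "VF Y" "VF Z"
  shows "R X Y Z = smul (ip (T Y) (T Z)) (P X) - smul (ip (T X) (T Z)) (P Y)"
proof -
  have "T (R X Y Z) = smul (ip (T Y) (T Z)) (T X) - smul (ip (T X) (T Z)) (T Y)"
    using R_T[OF v] R_T_0[OF v] by (simp add: algebra_simps)
  then have "P (R X Y Z) = smul (ip (T Y) (T Z)) (P X) - smul (ip (T X) (T Z)) (P Y)"
    using v by (intro ext) (simp add: P_def smul_apply scaleR_diff_right)
  moreover have "R X Y Z = P (R X Y Z)"
    using v R_T_0[of X Y "\<Phi> Z"] R_P[of X Y Z] R_xi[of X Y]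
    by (subst decomposition[of Z]) simp_all
  ultimately show ?thesis by simp
qed

text \<open>Cyclicity, tr(T phi) = tr(phi T) = 2 tr P, gives the second part of
  \<open>decomposition\<close> the same trace as \<open>P\<close>; hence 2n + 1 = 2 tr P + 1.
  Cyclicity itself is an exchange of sums after expanding by Parseval.\<close>

lemma trace_P:
  assumes E: "\<And>i. i < DIM('e) \<Longrightarrow> VF (E i)"
    "\<And>i. i < DIM('e) \<Longrightarrow> ip (E i) (E i) p = 1"
    "\<And>X Y. VF X \<Longrightarrow> VF Y \<Longrightarrow> (\<Sum>i<DIM('e). ip X (E i) p * ip Y (E i) p) = ip X Y p"
  shows "(\<Sum>i<DIM('e). ip (P (E i)) (E i) p) = real n"
proof -
  let ?d = "DIM('e)"
  have "(\<Sum>i<?d. ip (T (\<Phi> (E i))) (E i) p) = (\<Sum>i<?d. \<Sum>j<?d. ip (\<Phi> (E i)) (E j) p * ip (T (E j)) (E i) p)"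
  proof (intro sum.cong refl)
    fix i assume "i \<in> {..<?d}"
    then have v: "VF (E i)" using E(1) by simp
    have "ip (T (\<Phi> (E i))) (E i) p = ip (\<Phi> (E i)) (T (E i) + 2 *\<^sub>R \<Phi> (E i)) p"
      using v by (simp add: T_adjoint)
    also have "\<dots> = (\<Sum>j<?d. ip (\<Phi> (E i)) (E j) p * ip (T (E i) + 2 *\<^sub>R \<Phi> (E i)) (E j) p)"
      using v by (simp only: E(3) Phi_vf T_vf vector_field_add vector_field_scaleR)
    also have "\<dots> = (\<Sum>j<?d. ip (\<Phi> (E i)) (E j) p * ip (T (E j)) (E i) p)"
    proof (intro sum.cong refl)
      fix j assume "j \<in> {..<?d}"
      then have "VF (E j)" using E(1) by simp
      then have "ip (T (E i) + 2 *\<^sub>R \<Phi> (E i)) (E j) p = ip (T (E j)) (E i) p"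
        using v T_adjoint[of "E j" "E i" p] ip_sym[of "E j" "T (E i)" p] ip_sym[of "E j" "\<Phi> (E i)" p] by simp
      then show "ip (\<Phi> (E i)) (E j) p * ip (T (E i) + 2 *\<^sub>R \<Phi> (E i)) (E j) p =
          ip (\<Phi> (E i)) (E j) p * ip (T (E j)) (E i) p" by simp
    qed
    finally show "ip (T (\<Phi> (E i))) (E i) p = (\<Sum>j<?d. ip (\<Phi> (E i)) (E j) p * ip (T (E j)) (E i) p)" .
  qed
  also have "\<dots> = (\<Sum>j<?d. \<Sum>i<?d. ip (\<Phi> (E i)) (E j) p * ip (T (E j)) (E i) p)"
    by (rule sum.swap)
  also have "\<dots> = (\<Sum>j<?d. 2 * ip (P (E j)) (E j) p)"
  proof (intro sum.cong refl)
    fix j assume "j \<in> {..<?d}"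
    then have v: "VF (E j)" using E(1) by simp
    have "(\<Sum>i<?d. ip (\<Phi> (E i)) (E j) p * ip (T (E j)) (E i) p)
        = - (\<Sum>i<?d. ip (\<Phi> (E j)) (E i) p * ip (T (E j)) (E i) p)"
      unfolding sum_negf[symmetric]
    proof (intro sum.cong refl)
      fix i assume "i \<in> {..<?d}"
      then show "ip (\<Phi> (E i)) (E j) p * ip (T (E j)) (E i) p = - (ip (\<Phi> (E j)) (E i) p * ip (T (E j)) (E i) p)"
        using v E(1) Phi_skew[of "E i" "E j" p] ip_sym[of "E i" "\<Phi> (E j)" p] by simp
    qed
    also have "\<dots> = ip (\<Phi> (T (E j))) (E j) p"
      using v Phi_skew[of "T (E j)" "E j" p] ip_sym[of "T (E j)" "\<Phi> (E j)" p] by (simp add: E(3))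
    finally show "(\<Sum>i<?d. ip (\<Phi> (E i)) (E j) p * ip (T (E j)) (E i) p) = 2 * ip (P (E j)) (E j) p"
      using v by (simp add: Phi_T)
  qed
  finally have tr: "(\<Sum>i<?d. ip (T (\<Phi> (E i))) (E i) p) = 2 * (\<Sum>j<?d. ip (P (E j)) (E j) p)"
    by (simp add: sum_distrib_left)
  have "1 = ip (P (E i)) (E i) p + (1 / 2) * ip (T (\<Phi> (E i))) (E i) p + ip \<xi> (E i) p * ip \<xi> (E i) p"
    if "i < ?d" for i
  proof -
    have v: "VF (E i)" using E(1) that .
    have "1 = ip (P (E i) + (1 / 2) *\<^sub>R T (\<Phi> (E i)) + smul (ip (E i) \<xi>) \<xi>) (E i) p"
      using decomposition[OF v] E(2)[OF that] by simp
    then show ?thesis using v ip_sym[of "E i" \<xi> p] by simp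
  qed
  then have "(\<Sum>i<?d. 1) = (\<Sum>i<?d. ip (P (E i)) (E i) p + (1 / 2) * ip (T (\<Phi> (E i))) (E i) p
      + ip \<xi> (E i) p * ip \<xi> (E i) p)"
    by (intro sum.cong) auto
  then have "real ?d = (\<Sum>i<?d. ip (P (E i)) (E i) p) + (1 / 2) * (\<Sum>i<?d. ip (T (\<Phi> (E i))) (E i) p)
      + (\<Sum>i<?d. ip \<xi> (E i) p * ip \<xi> (E i) p)"
    by (simp only: sum.distrib sum_distrib_left[symmetric] sum_constant card_lessThan)
  moreover have "real ?d = 2 * real n + 1" by (simp add: DIM_eq)
  moreover have "(\<Sum>i<?d. ip \<xi> (E i) p * ip \<xi> (E i) p) = 1" using E(3)[of \<xi> \<xi>] by simp
  ultimately show ?thesis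
    using tr by linarith
qed

text \<open>The 4n is g(T Y, T Z) tr P; the -4 is the second term of \<open>curvature_eq\<close>,
  summed by Parseval and P^2 = P.\<close>

lemma ricci_eq:
  assumes v: "VF Y" "VF Z"
  shows "ricci A g nabla Y Z p = 4 * (real n - 1) * ip (P Y) Z p"
proof -
  obtain E where E: "\<And>i. i < DIM('e) \<Longrightarrow> VF (E i)"
    "\<And>i. i < DIM('e) \<Longrightarrow> ip (E i) (E i) p = 1"
    "\<And>X Y. VF X \<Longrightarrow> VF Y \<Longrightarrow> (\<Sum>i<DIM('e). ip X (E i) p * ip Y (E i) p) = ip X Y p"
    "\<And>Y Z. ricci A g nabla Y Z p = (\<Sum>i<DIM('e). ip (R (E i) Y Z) (E i) p)"
    by (rule ricci_frame[of p]) (rule that)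
  have "ip (R (E i) Y Z) (E i) p = ip (T Y) (T Z) p * ip (P (E i)) (E i) p
      - 4 * (ip (P Z) (E i) p * ip (P Y) (E i) p)" if "i < DIM('e)" for i
    using v E(1)[OF that] ip_sym[of "E i" "P Z" p]
    by (simp add: curvature_eq ip_T_T)
  then have "ricci A g nabla Y Z p = (\<Sum>i<DIM('e). ip (T Y) (T Z) p * ip (P (E i)) (E i) p
      - 4 * (ip (P Z) (E i) p * ip (P Y) (E i) p))"
    unfolding E(4) by (intro sum.cong) auto
  also have "\<dots> = ip (T Y) (T Z) p * real n - 4 * ip (P Z) (P Y) p"
    using v trace_P[OF E(1,2,3)] by (simp add: sum_subtractf sum_distrib_left[symmetric] E(3))
  also have "\<dots> = 4 * (real n - 1) * ip (P Y) Z p"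
    using v ip_sym[of "P Z" "P Y" p] by (simp add: ip_T_T P_adjoint algebra_simps)
  finally show ?thesis .
qed

text \<open>nabla_X D is a combination of X and P X with constant coefficients. As \<open>P\<close>
  is parallel and the torsion vanishes, the second derivatives of \<open>D\<close> differ by exactly
  its derivative along the bracket.\<close>

lemma soliton_nullity:
  assumes D: "VF D" and X: "VF X" and Y: "VF Y"
    and soliton: "\<And>X Y p. VF X \<Longrightarrow> VF Y \<Longrightarrow> ip (nabla X D) Y p = ricci A g nabla X Y p + lam * ip X Y p"
  shows "R X Y D = 0"
proof -
  have N: "nabla X D = (4 * (real n - 1)) *\<^sub>R P X + lam *\<^sub>R X" if "VF X" for X
    by (rule vf_eqI) (use that D soliton ricci_eq in simp_all)
  show ?thesis
    using X Y by (simp add: curvature_def lie_bracket_eq N nabla_P P_diff scaleR_diff_right)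
qed

end

theorem theorem3p3:
  fixes A :: "('m::{second_countable_topology, t2_space}, 'e::euclidean_space) chart set"
    and n :: nat
    and \<phi> :: "'m \<Rightarrow> 'm tangent \<Rightarrow> 'm tangent"
    and \<xi> :: "'m vfield"
    and \<eta> :: "'m \<Rightarrow> 'm tangent \<Rightarrow> real"
    and g :: "'m \<Rightarrow> 'm tangent \<Rightarrow> 'm tangent \<Rightarrow> real"
    and nabla :: "'m vfield \<Rightarrow> 'm vfield \<Rightarrow> 'm vfield"
    and k lam :: real
    and f :: "'m \<Rightarrow> real"
    and Df :: "'m vfield"
  assumes "levi_civita_connection A g nabla"
    and "Nk_contact_metric_manifold A n \<phi> \<xi> \<eta> g nabla k"
    and "gradient_ricci_soliton A g nabla f lam"
    and "is_gradient A g f Df"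
  shows "(\<forall>X Y. vector_field A X \<longrightarrow> vector_field A Y \<longrightarrow> curvature nabla X Y Df = 0) \<or>
         (lam < 0 \<and> einstein A g nabla \<and> sasakian A n \<phi> \<xi> \<eta> g) \<or>
         (lam = 0 \<and> DIM('e) = 3 \<and> flat A nabla)"
proof -
  have contact: "contact_metric_manifold A n \<phi> \<xi> \<eta> g"
    and nullity: "\<And>X Y. vector_field A X \<Longrightarrow> vector_field A Y \<Longrightarrow>
      curvature nabla X Y \<xi> = (\<lambda>p. k *\<^sub>R (\<eta> p (Y p) *\<^sub>R X p - \<eta> p (X p) *\<^sub>R Y p))"
    using assms(2) by (simp_all add: Nk_contact_metric_manifold_def)
  interpret contact_metric A g nabla n \<phi> \<xi> \<eta>
    using contact assms(1) by unfold_locales (simp_all add: contact_metric_manifold_def)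
  have R: "R X Y \<xi> = k *\<^sub>R (smul (ip Y \<xi>) X - smul (ip X \<xi>) Y)" if "VF X" "VF Y" for X Y
    using nullity[OF that] that by (simp add: fun_eq_iff smul_apply eta_eq)
  interpret gradient_soliton A g nabla n \<phi> \<xi> \<eta> k f lam Df
    by unfold_locales (fact R assms(3,4))+
  have "curvature nabla X Y Df = 0" if "VF X" "VF Y" for X Y
  proof (cases "k = 0")
    case True
    interpret zero_nullity A g nabla n \<phi> \<xi> \<eta>
      by unfold_locales (simp add: R True)
    show ?thesis
      by (rule soliton_nullity[OF D_vf that nabla_D])
  next
    case False
    then show ?thesis
      using that by (simp add: gradient_eq_0 curvature_def)
  qed
  then show ?thesis by blast
qed

end
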